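(* Let $(M,g,\mathcal{E})$ be an embedded ambient structure with Christoffel function $\Gamma$, and let $\hat g:TM\to L(\mathcal{E},\mathcal{E})$ be a smooth positive-definite operator-valued function. Let $G:TM\to L(\mathcal{E}^2,\mathcal{E}^2)$ be defined by $$G_{(x,v)}=\begin{bmatrix}I&\Gamma^{T}[v]_x\\0&I\end{bmatrix}\begin{bmatrix}g_x&0\\0&\hat g_{(x,v)}\end{bmatrix}\begin{bmatrix}I&0\\\Gamma[v]_x&I\end{bmatrix},\qquad (x,v)\in TM.$$ Then $(TM,G,\mathcal{E}^2)$ is an embedded ambient structure, and $$G_{(x,v)}^{-1}=\begin{bmatrix}I&0\\-\Gamma[v]_x&I\end{bmatrix}\begin{bmatrix}g_x^{-1}&0\\0&\hat g_{(x,v)}^{-1}\end{bmatrix}\begin{bmatrix}I&-\Gamma^{T}[v]_x\\0&I\end{bmatrix}.$$ The metric induced by $G$ is natural: for $(\Delta_m,\Delta_t)\in T_{(x,v)}TM$ the vertical component $(0,\Delta_t+\Gamma(\Delta_m,v)_x)$ and the horizontal component $(\Delta_m,-\Gamma(\Delta_m,v)_x)$ are orthogonal, and the bundle projection $\pi:TM\to M$ is a Riemannian submersion. Let $\Pi_{g,x}$ and $\Pi_{\hat g,x,v}$ be the projections of $\mathcal{E}$ onto $T_xM$ corresponding to $g_x$ and $\hat g_{(x,v)}$. Then the projection $\Pi_G$ from $\mathcal{E}^2$ to $T_{(x,v)}TM$ corresponding to $G$ is $$\Pi_{G,(x,v)}=\begin{bmatrix}I&0\\-\Gamma[v]_x&I\end{bmatrix}\begin{bmatrix}\Pi_{g,x}&0\\0&\Pi_{\hat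 g,x,v}\end{bmatrix}\begin{bmatrix}I&0\\\Gamma[v]_x&I\end{bmatrix},$$ i.e. for $(\omega_m,\omega_t)\in\mathcal{E}^2$, $$\Pi_{G,(x,v)}(\omega_m,\omega_t)=\big(\Pi_{g,x}\omega_m,\ (-\Gamma[v]_x\Pi_{g,x}+\Pi_{\hat g,x,v}\Gamma[v]_x)\omega_m+\Pi_{\hat g,x,v}\omega_t\big).$$ A Christoffel function $\Gamma_G$, evaluated at tangent vectors $\tilde\xi,\tilde\eta\in T_{(x,v)}TM\subset\mathcal{E}^2$, is given by $-(D_{\tilde\xi}\Pi_G)\tilde\eta+\mathring{\Gamma}_G(\tilde\xi,\tilde\eta)$ with $$\mathring{\Gamma}_G(\tilde\xi,\tilde\eta)=\Pi_GG^{-1}K_G(\tilde\xi,\tilde\eta),\qquad K_G(\tilde\xi,\tilde\eta)=\tfrac12\big((D_{\tilde\xi}G)\tilde\eta+(D_{\tilde\eta}G)\tilde\xi-\mathcal{X}_G(\tilde\xi,\tilde\eta)\big),$$ where $\mathcal{X}_G(\tilde\xi,\tilde\eta)$ satisfies $\langle\tilde\phi,\mathcal{X}_G(\tilde\xi,\tilde\eta)\rangle_{\mathcal{E}^2}=\langle\tilde\xi,(D_{\tilde\phi}G)\tilde\eta\rangle_{\mathcal{E}^2}$ for all tangent vectors $\tilde\xi,\tilde\eta,\tilde\phi$ of $TM$ at the same point.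
   Context: $\mathcal{E}$ is a finite-dimensional inner product space. An embedded ambient structure $(M,g,\mathcal{E})$ is a Riemannian manifold $M$ differentiably embedded in $\mathcal{E}$ with a metric operator $g$: a smooth map $M\to L(\mathcal{E},\mathcal{E})$, each $g_x$ self-adjoint positive-definite, such that $\langle\xi,g_x\eta\rangle_{\mathcal{E}}$ is the Riemannian inner product of $\xi,\eta\in T_xM\subset\mathcal{E}$. The projection to a subspace corresponding to a positive-definite operator $g$ is the one orthogonal for the inner product $\langle\cdot,g\cdot\rangle_{\mathcal{E}}$. A Christoffel function is a smooth $\Gamma:M\to L(\mathcal{E}\otimes\mathcal{E},\mathcal{E})$ (bilinear-map valued) with $\nabla_XY=D_XY+\Gamma(X,Y)$ for all vector fields $X,Y$ (as $\mathcal{E}$-valued functions), where $\nabla$ is the Levi-Civita connection and $D$ is directional derivative. For $\omega\in\mathcal{E}$, $\Gamma[\omega]_x\in L(\mathcal{E},\mathcal{E})$ is $\eta\mapsto\Gamma(\eta,\omega)_x$ and $\Gamma^T[\omega]_x$ is its adjoint under $\langle\cdot,\cdot\rangle_{\mathcal{E}}$. $TM=\{(x,v):x\in M,v\in T_xM\}\subset\mathcal{E}^2$, and $T_{(x,v)}TM\subset\mathcal{E}^2$. Block matrices act on pairs $(\omega_m,\omega_t)\in\mathcal{E}^2$ as column vectors. *)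

theory Defs
  imports "HOL-Analysis.Analysis"
begin

text \<open>
  Finite-dimensional inner product spaces are types of class \<^class>\<open>euclidean_space\<close>.
  Manifolds are subsets of such a space, and functions on a manifold \<open>M\<close> are total functions whose
  values outside \<open>M\<close> play no role.
\<close>

subsection \<open>Smooth maps, embedded submanifolds, tangent spaces\<close>

fun k_smooth_on :: "nat \<Rightarrow> 'a::real_normed_vector set \<Rightarrow> ('a \<Rightarrow> 'b::real_normed_vector) \<Rightarrow> bool" where
  "k_smooth_on 0 S f \<longleftrightarrow> continuous_on S f"
| "k_smooth_on (Suc k) S f \<longleftrightarrow>
     (\<forall>x\<in>S. f differentiable (at x)) \<and>
     (\<forall>v. k_smooth_on k S (\<lambda>x. frechet_derivative f (at x) v))"

text \<open>Infinitely often differentiable; only used for open \<open>S\<close> in a finite-dimensional space, where it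
  suffices to iterate the directional derivatives.\<close>

definition smooth_on :: "'a::real_normed_vector set \<Rightarrow> ('a \<Rightarrow> 'b::real_normed_vector) \<Rightarrow> bool" where
  "smooth_on S f \<longleftrightarrow> (\<forall>k. k_smooth_on k S f)"

definition smooth_map_on :: "'a::euclidean_space set \<Rightarrow> ('a \<Rightarrow> 'b::real_normed_vector) \<Rightarrow> bool" where
  "smooth_map_on M f \<longleftrightarrow>
     (\<forall>x\<in>M. \<exists>U F. open U \<and> x \<in> U \<and> smooth_on U F \<and> (\<forall>y\<in>U \<inter> M. F y = f y))"

definition embedded_submanifold :: "'a::euclidean_space set \<Rightarrow> bool" where
  "embedded_submanifold M \<longleftrightarrow>
     (\<exists>d. \<forall>x\<in>M. \<exists>U V \<phi> \<psi>. \<exists>L :: 'a set.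
        open U \<and> x \<in> U \<and> open V \<and>
        homeomorphism U V \<phi> \<psi> \<and> smooth_on U \<phi> \<and> smooth_on V \<psi> \<and>
        subspace L \<and> dim L = d \<and> \<phi> ` (U \<inter> M) = V \<inter> L)"

definition tangent_space :: "'a::euclidean_space set \<Rightarrow> 'a \<Rightarrow> 'a set" where
  "tangent_space M x =
     {v. \<exists>\<gamma> \<epsilon>. \<epsilon> > 0 \<and> smooth_on {-\<epsilon><..<\<epsilon>} \<gamma> \<and> \<gamma> ` {-\<epsilon><..<\<epsilon>} \<subseteq> M \<and> \<gamma> (0::real) = x \<and>
              (\<gamma> has_vector_derivative v) (at 0)}"

definition tangent_bundle :: "'a::euclidean_space set \<Rightarrow> ('a \<times> 'a) set" where
  "tangent_bundle M = {(x, v). x \<in> M \<and> v \<in> tangent_space M x}"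

text \<open>Directional derivative \<open>D\<^bsub>v\<^esub> f\<close> at \<open>x\<close> of a function on \<open>M\<close>.  A Frechet derivative within \<open>M\<close> is
  not unique, but its value on tangent vectors is: see \<open>dir_deriv_eq\<close> below.\<close>

definition dir_deriv :: "'a::euclidean_space set \<Rightarrow> ('a \<Rightarrow> 'b::real_normed_vector) \<Rightarrow> 'a \<Rightarrow> 'a \<Rightarrow> 'b" where
  "dir_deriv M f x v = frechet_derivative f (at x within M) v"

lemma dir_deriv_curve:
  assumes "f differentiable (at x within M)"
    and \<gamma>: "\<epsilon> > 0" "\<gamma> ` {-\<epsilon><..<\<epsilon>} \<subseteq> M" "\<gamma> (0::real) = x" "(\<gamma> has_vector_derivative v) (at 0)"
  shows "((f \<circ> \<gamma>) has_vector_derivative dir_deriv M f x v) (at 0)"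
proof -
  let ?I = "{-\<epsilon><..<\<epsilon>}"
  have "(f has_derivative frechet_derivative f (at x within M)) (at x within M)"
    using assms(1) by (simp add: frechet_derivative_works)
  then have f: "(f has_derivative frechet_derivative f (at x within M)) (at (\<gamma> 0) within \<gamma> ` ?I)"
    using \<gamma>(2,3) by (auto intro: has_derivative_subset)
  have "(\<gamma> has_vector_derivative v) (at 0 within ?I)"
    using \<gamma>(4) has_vector_derivative_at_within by blast
  from vector_derivative_diff_chain_within[OF this f]
  have "((f \<circ> \<gamma>) has_vector_derivative dir_deriv M f x v) (at 0 within ?I)"
    by (simp add: dir_deriv_def)
  then show ?thesis
    using \<gamma>(1) at_within_open[of 0 ?I] by simp
qed

lemma dir_deriv_eq:
  assumes f: "(f has_derivative f') (at x within M)" and v: "v \<in> tangent_space M x"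
  shows "dir_deriv M f x v = f' v"
proof -
  obtain \<gamma> \<epsilon> where \<gamma>: "\<epsilon> > 0" "\<gamma> ` {-\<epsilon><..<\<epsilon>} \<subseteq> M" "\<gamma> (0::real) = x"
      "(\<gamma> has_vector_derivative v) (at 0)"
    using v by (auto simp: tangent_space_def)
  let ?I = "{-\<epsilon><..<\<epsilon>}"
  have 1: "((f \<circ> \<gamma>) has_vector_derivative dir_deriv M f x v) (at 0)"
    using dir_deriv_curve[OF _ \<gamma>] f by (auto simp: differentiable_def)
  have "(f has_derivative f') (at (\<gamma> 0) within \<gamma> ` ?I)"
    using f \<gamma>(2,3) by (auto intro: has_derivative_subset)
  from vector_derivative_diff_chain_within[OF has_vector_derivative_at_within[OF \<gamma>(4)] this]
  have "((f \<circ> \<gamma>) has_vector_derivative f' v) (at 0 within ?I)" .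
  then have "((f \<circ> \<gamma>) has_vector_derivative f' v) (at 0)"
    using \<gamma>(1) at_within_open[of 0 ?I] by simp
  with 1 show ?thesis
    by (rule vector_derivative_unique_at)
qed

subsection \<open>Operators\<close>

definition pos_def_operator :: "('a::euclidean_space \<Rightarrow>\<^sub>L 'a) \<Rightarrow> bool" where
  "pos_def_operator A \<longleftrightarrow>
     (\<forall>u w. A u \<bullet> w = u \<bullet> A w) \<and> (\<forall>u. u \<noteq> 0 \<longrightarrow> 0 < u \<bullet> A u)"

definition adjoint_operator :: "('a::euclidean_space \<Rightarrow>\<^sub>L 'a) \<Rightarrow> 'a \<Rightarrow>\<^sub>L 'a" where
  "adjoint_operator A = Blinfun (adjoint (blinfun_apply A))"

definition inverse_operator :: "('a::euclidean_space \<Rightarrow>\<^sub>L 'a) \<Rightarrow> 'a \<Rightarrow>\<^sub>L 'a" where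
  "inverse_operator A = (THE B. A o\<^sub>L B = id_blinfun \<and> B o\<^sub>L A = id_blinfun)"

text \<open>The projection onto the subspace \<open>S\<close> that is orthogonal for the inner product
  \<open>\<lambda>u w. u \<bullet> A w\<close>, where \<open>A\<close> is positive-definite.\<close>

definition projection :: "('a::euclidean_space \<Rightarrow>\<^sub>L 'a) \<Rightarrow> 'a set \<Rightarrow> 'a \<Rightarrow>\<^sub>L 'a" where
  "projection A S =
     (THE P :: 'a \<Rightarrow>\<^sub>L 'a. (\<forall>w. P w \<in> S) \<and> (\<forall>w. \<forall>s\<in>S. s \<bullet> A (w - P w) = 0))"

text \<open>\<open>block_operator A B C D\<close> is the block matrix with rows \<open>A B\<close> and \<open>C D\<close>.\<close>

definition block_operator ::
    "('a::euclidean_space \<Rightarrow>\<^sub>L 'a) \<Rightarrow> ('a \<Rightarrow>\<^sub>L 'a) \<Rightarrow> ('a \<Rightarrow>\<^sub>L 'a) \<Rightarrow> ('a \<Rightarrow>\<^sub>L 'a) \<Rightarrow> ('a \<times> 'a) \<Rightarrow>\<^sub>L ('a \<times> 'a)" where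
  "block_operator A B C D = Blinfun (\<lambda>(m, t). (A m + B t, C m + D t))"

lemma block_operator_apply [simp]:
  "blinfun_apply (block_operator A B C D) (m, t) = (A m + B t, C m + D t)"
proof -
  have "bounded_linear (\<lambda>p. (A (fst p) + B (snd p), C (fst p) + D (snd p)))"
    by (intro bounded_linear_Pair bounded_linear_add
        bounded_linear_compose[OF blinfun.bounded_linear_right]
        bounded_linear_fst bounded_linear_snd)
  then show ?thesis
    by (simp add: block_operator_def case_prod_unfold bounded_linear_Blinfun_apply)
qed

subsection \<open>Embedded ambient structures and Christoffel functions\<close>

text \<open>The Riemannian metric on \<open>M\<close> is \<open>\<xi>, \<eta> \<mapsto> \<xi> \<bullet> g x \<eta>\<close> for \<open>\<xi>, \<eta> \<in> tangent_space M x\<close>.\<close>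

definition embedded_ambient_structure ::
    "'a::euclidean_space set \<Rightarrow> ('a \<Rightarrow> 'a \<Rightarrow>\<^sub>L 'a) \<Rightarrow> bool" where
  "embedded_ambient_structure M g \<longleftrightarrow>
     embedded_submanifold M \<and> smooth_map_on M g \<and> (\<forall>x\<in>M. pos_def_operator (g x))"

definition vector_field :: "'a::euclidean_space set \<Rightarrow> ('a \<Rightarrow> 'a) \<Rightarrow> bool" where
  "vector_field M X \<longleftrightarrow> smooth_map_on M X \<and> (\<forall>x\<in>M. X x \<in> tangent_space M x)"

definition affine_connection ::
    "'a::euclidean_space set \<Rightarrow> (('a \<Rightarrow> 'a) \<Rightarrow> ('a \<Rightarrow> 'a) \<Rightarrow> 'a \<Rightarrow> 'a) \<Rightarrow> bool" where
  "affine_connection M nabla \<longleftrightarrow>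
     (\<forall>X Y. vector_field M X \<and> vector_field M Y \<longrightarrow> vector_field M (nabla X Y)) \<and>
     (\<forall>X X' Y. vector_field M X \<and> vector_field M X' \<and> vector_field M Y \<longrightarrow>
        (\<forall>x\<in>M. nabla (\<lambda>y. X y + X' y) Y x = nabla X Y x + nabla X' Y x)) \<and>
     (\<forall>X Y Y'. vector_field M X \<and> vector_field M Y \<and> vector_field M Y' \<longrightarrow>
        (\<forall>x\<in>M. nabla X (\<lambda>y. Y y + Y' y) x = nabla X Y x + nabla X Y' x)) \<and>
     (\<forall>(f :: 'a \<Rightarrow> real) X Y. smooth_map_on M f \<and> vector_field M X \<and> vector_field M Y \<longrightarrow>
        (\<forall>x\<in>M. nabla (\<lambda>y. f y *\<^sub>R X y) Y x = f x *\<^sub>R nabla X Y x \<and>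
               nabla X (\<lambda>y. f y *\<^sub>R Y y) x
                 = dir_deriv M f x (X x) *\<^sub>R Y x + f x *\<^sub>R nabla X Y x))"

text \<open>For vector fields regarded as functions with values in the ambient space.\<close>

definition lie_bracket :: "'a::euclidean_space set \<Rightarrow> ('a \<Rightarrow> 'a) \<Rightarrow> ('a \<Rightarrow> 'a) \<Rightarrow> 'a \<Rightarrow> 'a" where
  "lie_bracket M X Y x = dir_deriv M Y x (X x) - dir_deriv M X x (Y x)"

definition levi_civita ::
    "'a::euclidean_space set \<Rightarrow> ('a \<Rightarrow> 'a \<Rightarrow>\<^sub>L 'a) \<Rightarrow> (('a \<Rightarrow> 'a) \<Rightarrow> ('a \<Rightarrow> 'a) \<Rightarrow> 'a \<Rightarrow> 'a) \<Rightarrow> bool" where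
  "levi_civita M g nabla \<longleftrightarrow>
     affine_connection M nabla \<and>
     (\<forall>X Y. vector_field M X \<and> vector_field M Y \<longrightarrow>
        (\<forall>x\<in>M. nabla X Y x - nabla Y X x = lie_bracket M X Y x)) \<and>
     (\<forall>X Y Z. vector_field M X \<and> vector_field M Y \<and> vector_field M Z \<longrightarrow>
        (\<forall>x\<in>M. dir_deriv M (\<lambda>y. X y \<bullet> g y (Y y)) x (Z x)
                 = nabla Z X x \<bullet> g x (Y x) + X x \<bullet> g x (nabla Z Y x)))"

text \<open>\<open>\<Gamma> x \<xi> \<eta>\<close> stands for \<open>\<Gamma>(\<xi>, \<eta>)\<close> at \<open>x\<close>; bilinear maps are curried.\<close>

definition christoffel_function ::
    "'a::euclidean_space set \<Rightarrow> ('a \<Rightarrow> 'a \<Rightarrow>\<^sub>L 'a) \<Rightarrow> ('a \<Rightarrow> 'a \<Rightarrow>\<^sub>L 'a \<Rightarrow>\<^sub>L 'a) \<Rightarrow> bool" where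
  "christoffel_function M g \<Gamma> \<longleftrightarrow>
     smooth_map_on M \<Gamma> \<and>
     (\<exists>nabla. levi_civita M g nabla \<and>
        (\<forall>X Y. vector_field M X \<and> vector_field M Y \<longrightarrow>
           (\<forall>x\<in>M. nabla X Y x = dir_deriv M Y x (X x) + \<Gamma> x (X x) (Y x))))"

text \<open>The operator \<open>\<Gamma>[\<omega>]\<close> at \<open>x\<close>: the vector \<open>\<omega>\<close> fills the second argument.\<close>

definition christoffel_op ::
    "('a::euclidean_space \<Rightarrow> 'a \<Rightarrow>\<^sub>L 'a \<Rightarrow>\<^sub>L 'a) \<Rightarrow> 'a \<Rightarrow> 'a \<Rightarrow> 'a \<Rightarrow>\<^sub>L 'a" where
  "christoffel_op \<Gamma> \<omega> x = Blinfun (\<lambda>\<eta>. \<Gamma> x \<eta> \<omega>)"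

lemma christoffel_op_apply [simp]: "blinfun_apply (christoffel_op \<Gamma> \<omega> x) \<eta> = \<Gamma> x \<eta> \<omega>"
proof -
  have "bounded_linear (\<lambda>\<eta>. \<Gamma> x \<eta> \<omega>)"
    by (rule bounded_linear_compose[OF blinfun.bounded_linear_left blinfun.bounded_linear_right])
  then show ?thesis
    by (simp add: christoffel_op_def bounded_linear_Blinfun_apply)
qed

subsection \<open>Riemannian submersions\<close>

definition vertical_space ::
    "'a::euclidean_space set \<Rightarrow> ('a \<Rightarrow> 'b::euclidean_space) \<Rightarrow> 'a \<Rightarrow> 'a set" where
  "vertical_space N p x = {\<xi> \<in> tangent_space N x. dir_deriv N p x \<xi> = 0}"

definition horizontal_space ::
    "'a::euclidean_space set \<Rightarrow> ('a \<Rightarrow> 'a \<Rightarrow>\<^sub>L 'a) \<Rightarrow> ('a \<Rightarrow> 'b::euclidean_space) \<Rightarrow> 'a \<Rightarrow> 'a set" where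
  "horizontal_space N h p x = {\<xi> \<in> tangent_space N x. \<forall>\<zeta>\<in>vertical_space N p x. \<zeta> \<bullet> h x \<xi> = 0}"

definition riemannian_submersion ::
    "'a::euclidean_space set \<Rightarrow> ('a \<Rightarrow> 'a \<Rightarrow>\<^sub>L 'a) \<Rightarrow>
     'b::euclidean_space set \<Rightarrow> ('b \<Rightarrow> 'b \<Rightarrow>\<^sub>L 'b) \<Rightarrow> ('a \<Rightarrow> 'b) \<Rightarrow> bool" where
  "riemannian_submersion N h M g p \<longleftrightarrow>
     smooth_map_on N p \<and> p ` N = M \<and>
     (\<forall>x\<in>N. dir_deriv N p x ` tangent_space N x = tangent_space M (p x) \<and>
        (\<forall>\<xi>\<in>horizontal_space N h p x. \<forall>\<eta>\<in>horizontal_space N h p x.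
           dir_deriv N p x \<xi> \<bullet> g (p x) (dir_deriv N p x \<eta>) = \<xi> \<bullet> h x \<eta>))"

subsection \<open>The operator formula for a Christoffel function\<close>

definition tangent_projection :: "'a::euclidean_space set \<Rightarrow> ('a \<Rightarrow> 'a \<Rightarrow>\<^sub>L 'a) \<Rightarrow> 'a \<Rightarrow> 'a \<Rightarrow>\<^sub>L 'a" where
  "tangent_projection N G p = projection (G p) (tangent_space N p)"

text \<open>The defining property of \<open>\<X>\<close> determines \<open>\<X> p \<xi> \<eta>\<close> only up to a vector orthogonal (for \<open>\<bullet>\<close>)
  to the tangent space, so it is a predicate.\<close>

definition is_chi ::
    "'a::euclidean_space set \<Rightarrow> ('a \<Rightarrow> 'a \<Rightarrow>\<^sub>L 'a) \<Rightarrow> ('a \<Rightarrow> 'a \<Rightarrow> 'a \<Rightarrow> 'a) \<Rightarrow> bool" where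
  "is_chi N G \<X> \<longleftrightarrow>
     (\<forall>p\<in>N. \<forall>\<xi>\<in>tangent_space N p. \<forall>\<eta>\<in>tangent_space N p. \<forall>\<phi>\<in>tangent_space N p.
        \<phi> \<bullet> \<X> p \<xi> \<eta> = \<xi> \<bullet> dir_deriv N G p \<phi> \<eta>)"

definition christoffel_K ::
    "'a::euclidean_space set \<Rightarrow> ('a \<Rightarrow> 'a \<Rightarrow>\<^sub>L 'a) \<Rightarrow> ('a \<Rightarrow> 'a \<Rightarrow> 'a \<Rightarrow> 'a) \<Rightarrow> 'a \<Rightarrow> 'a \<Rightarrow> 'a \<Rightarrow> 'a" where
  "christoffel_K N G \<X> p \<xi> \<eta> =
     (1/2) *\<^sub>R (dir_deriv N G p \<xi> \<eta> + dir_deriv N G p \<eta> \<xi> - \<X> p \<xi> \<eta>)"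

definition christoffel_ring ::
    "'a::euclidean_space set \<Rightarrow> ('a \<Rightarrow> 'a \<Rightarrow>\<^sub>L 'a) \<Rightarrow> ('a \<Rightarrow> 'a \<Rightarrow> 'a \<Rightarrow> 'a) \<Rightarrow> 'a \<Rightarrow> 'a \<Rightarrow> 'a \<Rightarrow> 'a" where
  "christoffel_ring N G \<X> p \<xi> \<eta> =
     tangent_projection N G p (inverse_operator (G p) (christoffel_K N G \<X> p \<xi> \<eta>))"

end

theory Submission
  imports Defs
begin

text \<open>
  The key is a description of the tangent spaces of \<open>TM\<close> (lemma \<open>tangent_space_TM\<close>): a pair
  \<open>(a, b)\<close> is tangent to \<open>TM\<close> at \<open>(x, v)\<close> exactly when \<open>a\<close> and \<open>b + \<Gamma>(a, v)\<close> both lie in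
  \<open>T\<^sub>xM\<close>.  Write \<open>P\<close> for the field of projections onto the tangent spaces of \<open>M\<close>.  The fields
  \<open>P \<xi>\<close> and \<open>P \<eta>\<close> are tangent, hence so is their covariant derivative; this says that
  \<open>(D\<^bsub>\<xi>\<^esub> P) \<eta> + \<Gamma>(\<xi>, \<eta>)\<close> is tangent for tangent \<open>\<xi>\<close>, \<open>\<eta>\<close>.  Now a curve \<open>(x(t), v(t))\<close> in
  \<open>TM\<close> satisfies \<open>v = P v\<close>, so \<open>v' = (D\<^bsub>x'\<^esub> P) v + P v'\<close> and \<open>v' + \<Gamma>(x', v)\<close> is tangent.
  Conversely, if \<open>\<gamma>\<close> is a curve in \<open>M\<close> with velocity \<open>a\<close>, the curve
  \<open>t \<mapsto> (\<gamma>(t), P (v + t w))\<close>, with \<open>P\<close> taken at \<open>\<gamma>(t)\<close>, realises every pair \<open>(a, b)\<close> of the required form,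
  with \<open>w = b - (D\<^sub>a P) v\<close>.

  So the shear \<open>S (a, b) = (a, b + \<Gamma>(a, v))\<close> maps the tangent space of \<open>TM\<close> onto
  \<open>T\<^sub>xM \<times> T\<^sub>xM\<close>, and the definition of \<open>G\<close> reads \<open>G = S\<^sup>T diag(g, ghat) S\<close>.  Positive
  definiteness, the inverse, the orthogonal splitting into horizontal and vertical vectors, the
  submersion property and the formula for the projection are the corresponding facts for the
  block-diagonal inner product, carried over by \<open>S\<close>.  That \<open>TM\<close> is a submanifold is seen in the
  charts \<open>(y, w) \<mapsto> (\<phi> y, D\<phi> y w)\<close>.

  The formula for a Christoffel function is proved for an arbitrary embedded ambient structure
  \<open>(N, G)\<close> with projections \<open>P\<close> (lemma \<open>christoffel_operator_formula\<close>).  Differentiating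
  \<open>Y = P Y\<close> gives \<open>D\<^sub>X Y - (D\<^sub>X P) Y = P (D\<^sub>X Y)\<close>, so the formula amounts to
  \<open>\<nabla>\<^sub>X Y = P (D\<^sub>X Y + G\<^sup>-\<^sup>1 K(X, Y))\<close>.  Compatibility with the metric is the polarisation identity
  behind the definition of \<open>K\<close>.  As \<open>K\<close> is symmetric up to vectors orthogonal to the tangent space,
  the torsion vanishes once Lie brackets of tangent fields are tangent, and this follows from the
  symmetry of second derivatives of functions that vanish on \<open>N\<close>.  Smoothness of \<open>\<nabla>\<close> needs that \<open>P\<close> is
  smooth, for which \<open>P\<close> is written in a chart by means of an invertible operator; it remains to
  know that operator inversion preserves smoothness.
\<close>

section \<open>Calculus of smooth functions on open sets\<close>

lemma k_smooth_on_cong: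
  assumes "open S" and eq: "\<And>x. x \<in> S \<Longrightarrow> f x = g x" and "k_smooth_on k S f"
  shows "k_smooth_on k S g"
  using eq assms(3)
proof (induction k arbitrary: f g)
  case 0
  then show ?case by (simp cong: continuous_on_cong_simp)
next
  case (Suc k)
  have f: "f differentiable (at x)" if "x \<in> S" for x using Suc.prems(2) that by simp
  have g: "(g has_derivative frechet_derivative f (at x)) (at x)" if "x \<in> S" for x
    using has_derivative_transform_within_open[OF _ \<open>open S\<close> that Suc.prems(1)] f[OF that]
    by (simp add: frechet_derivative_works)
  have eq': "frechet_derivative f (at x) v = frechet_derivative g (at x) v" if "x \<in> S" for x v
    using frechet_derivative_at[OF g[OF that]] by simp
  show ?case
    using g Suc.IH[OF eq'] Suc.prems(2) by (auto simp: differentiable_def)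
qed

lemma k_smooth_on_subset: "k_smooth_on k S f \<Longrightarrow> T \<subseteq> S \<Longrightarrow> k_smooth_on k T f"
  by (induction k arbitrary: f) (auto intro: continuous_on_subset)

lemma k_smooth_on_locally:
  assumes "\<And>x. x \<in> S \<Longrightarrow> \<exists>U. open U \<and> x \<in> U \<and> k_smooth_on k U f"
  shows "k_smooth_on k S f"
  using assms
proof (induction k arbitrary: f)
  case 0
  have "continuous (at x) f" if "x \<in> S" for x
  proof -
    from 0[OF that] obtain U where "open U" "x \<in> U" "continuous_on U f" by auto
    then show ?thesis by (simp add: continuous_on_eq_continuous_at)
  qed
  then show ?case by (simp add: continuous_at_imp_continuous_on)
next
  case (Suc k)
  have "f differentiable (at x)" if "x \<in> S" for x using Suc.prems[OF that] by auto
  moreover have "k_smooth_on k S (\<lambda>x. frechet_derivative f (at x) v)" for v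
  proof (rule Suc.IH)
    fix x assume "x \<in> S"
    then obtain U where "open U" "x \<in> U" "k_smooth_on (Suc k) U f" using Suc.prems by blast
    then show "\<exists>U. open U \<and> x \<in> U \<and> k_smooth_on k U (\<lambda>x. frechet_derivative f (at x) v)"
      by (intro exI[of _ U]) simp
  qed
  ultimately show ?case by simp
qed

lemma k_smooth_on_SucD: "k_smooth_on (Suc k) S f \<Longrightarrow> k_smooth_on k S f"
proof (induction k arbitrary: f)
  case 0
  then show ?case
    by (auto intro!: continuous_at_imp_continuous_on differentiable_imp_continuous_within)
next
  case (Suc k)
  then show ?case by (metis k_smooth_on.simps(2))
qed

text \<open>Any family of Frechet derivatives may serve in place of the chosen one.  With this rule and
  \<open>k_smooth_on_SucE\<close> below, each closure property is an induction on the order that only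
  uses the corresponding differentiation rule.\<close>

lemma k_smooth_on_SucI:
  assumes "open S" and der: "\<And>x. x \<in> S \<Longrightarrow> (f has_derivative f' x) (at x)"
    and "\<And>v. k_smooth_on k S (\<lambda>x. f' x v)"
  shows "k_smooth_on (Suc k) S f"
proof -
  have "f' x v = frechet_derivative f (at x) v" if "x \<in> S" for x v
    using frechet_derivative_at[OF der[OF that]] by simp
  then show ?thesis
    using der k_smooth_on_cong[OF \<open>open S\<close> _ assms(3)] by (auto simp: differentiable_def)
qed

lemma k_smooth_on_SucE:
  assumes "k_smooth_on (Suc k) S f"
  obtains f' where "\<And>x. x \<in> S \<Longrightarrow> (f has_derivative f' x) (at x)"
    "\<And>v. k_smooth_on k S (\<lambda>x. f' x v)"
proof (rule that)
  show "(f has_derivative frechet_derivative f (at x)) (at x)" if "x \<in> S" for x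
    using assms that by (simp add: frechet_derivative_works)
  show "k_smooth_on k S (\<lambda>x. frechet_derivative f (at x) v)" for v using assms by simp
qed

lemma k_smooth_on_const: "open S \<Longrightarrow> k_smooth_on k S (\<lambda>x. c)"
  by (induction k arbitrary: c) (auto intro!: continuous_on_const)

lemma k_smooth_on_bounded_linear:
  assumes "bounded_linear h" "open S"
  shows "k_smooth_on k S h"
proof (cases k)
  case 0
  then show ?thesis using assms by (simp add: linear_continuous_on)
next
  case (Suc j)
  show ?thesis unfolding Suc
    by (rule k_smooth_on_SucI[OF assms(2) bounded_linear_imp_has_derivative[OF assms(1)]])
      (rule k_smooth_on_const[OF assms(2)])
qed

lemma k_smooth_on_add:
  assumes "open S" "k_smooth_on k S f" "k_smooth_on k S g"
  shows "k_smooth_on k S (\<lambda>x. f x + g x)"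
  using assms(2,3)
proof (induction k arbitrary: f g)
  case 0
  then show ?case by (auto intro: continuous_on_add)
next
  case (Suc k)
  obtain f' where f': "\<And>x. x \<in> S \<Longrightarrow> (f has_derivative f' x) (at x)"
    "\<And>v. k_smooth_on k S (\<lambda>x. f' x v)" using k_smooth_on_SucE[OF Suc.prems(1)] by blast
  obtain g' where g': "\<And>x. x \<in> S \<Longrightarrow> (g has_derivative g' x) (at x)"
    "\<And>v. k_smooth_on k S (\<lambda>x. g' x v)" using k_smooth_on_SucE[OF Suc.prems(2)] by blast
  show ?case
    by (rule k_smooth_on_SucI[OF assms(1) has_derivative_add[OF f'(1) g'(1)] Suc.IH[OF f'(2) g'(2)]])
qed

lemma k_smooth_on_sum:
  assumes "open S" "\<And>i. i \<in> I \<Longrightarrow> k_smooth_on k S (f i)"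
  shows "k_smooth_on k S (\<lambda>x. \<Sum>i\<in>I. f i x)"
  using assms(2)
  by (induction I rule: infinite_finite_induct)
    (auto intro: k_smooth_on_add[OF assms(1)] k_smooth_on_const[OF assms(1)])

lemma k_smooth_on_bilinear:
  assumes "open S" and h: "bounded_bilinear h" and "k_smooth_on k S f" "k_smooth_on k S g"
  shows "k_smooth_on k S (\<lambda>x. h (f x) (g x))"
  using assms(3,4)
proof (induction k arbitrary: f g)
  case 0
  then show ?case by (auto intro: bounded_bilinear.continuous_on[OF h])
next
  case (Suc k)
  obtain f' where f': "\<And>x. x \<in> S \<Longrightarrow> (f has_derivative f' x) (at x)"
    "\<And>v. k_smooth_on k S (\<lambda>x. f' x v)" using k_smooth_on_SucE[OF Suc.prems(1)] by blast
  obtain g' where g': "\<And>x. x \<in> S \<Longrightarrow> (g has_derivative g' x) (at x)"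
    "\<And>v. k_smooth_on k S (\<lambda>x. g' x v)" using k_smooth_on_SucE[OF Suc.prems(2)] by blast
  show ?case
    by (rule k_smooth_on_SucI[OF assms(1) bounded_bilinear.FDERIV[OF h f'(1) g'(1)]
          k_smooth_on_add[OF assms(1) Suc.IH[OF k_smooth_on_SucD[OF Suc.prems(1)] g'(2)]
            Suc.IH[OF f'(2) k_smooth_on_SucD[OF Suc.prems(2)]]]])
qed

lemma k_smooth_on_linear_comp:
  assumes "open S" and h: "bounded_linear h" and "k_smooth_on k S f"
  shows "k_smooth_on k S (\<lambda>x. h (f x))"
  using assms(3)
proof (induction k arbitrary: f)
  case 0
  then show ?case by (auto intro: bounded_linear.continuous_on[OF h])
next
  case (Suc k)
  obtain f' where f': "\<And>x. x \<in> S \<Longrightarrow> (f has_derivative f' x) (at x)"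
    "\<And>v. k_smooth_on k S (\<lambda>x. f' x v)" using k_smooth_on_SucE[OF Suc.prems(1)] by blast
  show ?case
    by (rule k_smooth_on_SucI[OF assms(1) bounded_linear.has_derivative[OF h f'(1)] Suc.IH[OF f'(2)]])
qed

lemma linear_eq_sum_Basis:
  assumes "linear h"
  shows "h (y::'a::euclidean_space) = (\<Sum>b\<in>Basis. (y \<bullet> b) *\<^sub>R h b)"
proof -
  have "h (\<Sum>b\<in>Basis. (y \<bullet> b) *\<^sub>R b) = (\<Sum>b\<in>Basis. (y \<bullet> b) *\<^sub>R h b)"
    by (simp only: linear_sum[OF assms] linear_cmul[OF assms])
  then show ?thesis by (simp only: euclidean_representation)
qed

text \<open>In the chain rule the inner derivative enters as an argument of the outer one, which is not
  a directional derivative of \<open>g\<close> in a fixed direction.  Expanding it in a basis of the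
  finite-dimensional middle space leaves derivatives of \<open>g\<close> in fixed directions, to which the
  induction hypothesis applies.\<close>

lemma k_smooth_on_compose:
  fixes f :: "'a::real_normed_vector \<Rightarrow> 'b::euclidean_space"
  assumes "open S" "open T" "f ` S \<subseteq> T" and "k_smooth_on k S f" "k_smooth_on k T g"
  shows "k_smooth_on k S (\<lambda>x. g (f x))"
  using assms(4,5)
proof (induction k arbitrary: g)
  case 0
  then show ?case using continuous_on_compose2[of T g S f] assms(3) by auto
next
  case (Suc k)
  obtain f' where f': "\<And>x. x \<in> S \<Longrightarrow> (f has_derivative f' x) (at x)"
    "\<And>v. k_smooth_on k S (\<lambda>x. f' x v)" using k_smooth_on_SucE[OF Suc.prems(1)] by blast
  obtain g' where g': "\<And>x. x \<in> T \<Longrightarrow> (g has_derivative g' x) (at x)"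
    "\<And>v. k_smooth_on k T (\<lambda>x. g' x v)" using k_smooth_on_SucE[OF Suc.prems(2)] by blast
  have g'': "(g has_derivative g' (f x)) (at (f x))" if "x \<in> S" for x
    using g'(1) assms(3) that by auto
  have eq: "(\<Sum>b\<in>Basis. (f' x v \<bullet> b) *\<^sub>R g' (f x) b) = g' (f x) (f' x v)" if "x \<in> S" for x v
    by (rule linear_eq_sum_Basis[symmetric]) (rule has_derivative_linear[OF g''[OF that]])
  have "k_smooth_on k S (\<lambda>x. \<Sum>b\<in>Basis. (f' x v \<bullet> b) *\<^sub>R g' (f x) b)" for v
    by (intro k_smooth_on_sum[OF assms(1)] k_smooth_on_bilinear[OF assms(1) bounded_bilinear_scaleR]
        k_smooth_on_linear_comp[OF assms(1) bounded_linear_inner_left] f'(2)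
        Suc.IH[OF k_smooth_on_SucD[OF Suc.prems(1)] g'(2)])
  then have "k_smooth_on k S (\<lambda>x. g' (f x) (f' x v))" for v
    by (rule k_smooth_on_cong[OF assms(1) eq, rotated])
  then show ?case
    by (intro k_smooth_on_SucI[OF assms(1) has_derivative_compose[OF f'(1) g'']])
qed

text \<open>A product rule in which one factor is merely continuous, provided that the other one vanishes
  at the point.  It is applied to \<open>A\<^sup>-\<^sup>1(y) - A\<^sup>-\<^sup>1(x) = - A\<^sup>-\<^sup>1(y) (A(y) - A(x)) A\<^sup>-\<^sup>1(x)\<close>, where
  the differentiability of \<open>A\<^sup>-\<^sup>1(y)\<close> is still to be shown.\<close>

lemma has_derivative_bilinear_at_zero:
  assumes h: "bounded_bilinear h" and B: "continuous (at x) B"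
    and A: "(A has_derivative A') (at x)" and [simp]: "A x = 0"
  shows "((\<lambda>y. h (B y) (A y)) has_derivative (\<lambda>v. h (B x) (A' v))) (at x)"
proof -
  interpret h: bounded_bilinear h by (rule h)
  have A'0: "bounded_linear A'" using A by (rule has_derivative_bounded_linear)
  obtain K where K: "\<And>v. norm (A' v) \<le> norm v * K" using bounded_linear.bounded[OF A'0] by blast
  let ?q = "\<lambda>y. (1 / norm (y - x)) *\<^sub>R (A y - A' (y - x))"
  have q: "(?q \<longlongrightarrow> 0) (at x)"
    using A by (simp add: has_derivative_at_within divide_inverse_commute)
  have Bx: "((\<lambda>y. B y - B x) \<longlongrightarrow> 0) (at x)"
    using B by (simp add: continuous_at LIM_zero_iff)
  have "((\<lambda>y. h (B y) (?q y)) \<longlongrightarrow> h (B x) 0) (at x)"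
    using B q by (intro h.tendsto) (simp_all add: continuous_at)
  moreover have "((\<lambda>y. h (B y - B x) ((1 / norm (y - x)) *\<^sub>R A' (y - x))) \<longlongrightarrow> 0) (at x)"
  proof -
    have "Zfun (\<lambda>y. h (B y - B x) ((1 / norm (y - x)) *\<^sub>R A' (y - x))) (at x)"
    proof (rule bounded_bilinear.Zfun_prod_Bfun[OF h])
      show "Zfun (\<lambda>y. B y - B x) (at x)" using Bx by (simp add: tendsto_Zfun_iff)
      show "Bfun (\<lambda>y. (1 / norm (y - x)) *\<^sub>R A' (y - x)) (at x)"
      proof (rule BfunI)
        show "\<forall>\<^sub>F y in at x. norm ((1 / norm (y - x)) *\<^sub>R A' (y - x)) \<le> K"
          unfolding eventually_at_filter
          using K by (auto intro!: always_eventually simp: divide_le_eq mult.commute)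
      qed
    qed
    then show ?thesis by (simp add: tendsto_Zfun_iff)
  qed
  ultimately have *: "((\<lambda>y. h (B y) (?q y) + h (B y - B x) ((1 / norm (y - x)) *\<^sub>R A' (y - x))) \<longlongrightarrow> 0) (at x)"
    using tendsto_add by (fastforce simp: h.zero_right)
  have eq: "h (B y) (?q y) + h (B y - B x) ((1 / norm (y - x)) *\<^sub>R A' (y - x))
      = (1 / norm (y - x)) *\<^sub>R (h (B y) (A y) - h (B x) (A' (y - x)))" for y
    by (simp add: h.diff_left h.diff_right h.scaleR_right scaleR_diff_right)
  show ?thesis
    unfolding has_derivative_at_within
    using *[unfolded eq] bounded_linear_compose[OF h.bounded_linear_right A'0]
    by (simp add: h.zero_right divide_inverse_commute)
qed

text \<open>The resolvent identity \<open>B(y) - B(x) = - B(y) (A(y) - A(x)) B(x)\<close> first bounds the norm of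
  \<open>B(y)\<close> near \<open>x\<close> by twice that of \<open>B(x)\<close> and then gives continuity.\<close>

lemma inverse_blinfun_continuous:
  fixes A B :: "'a::real_normed_vector \<Rightarrow> 'b::real_normed_vector \<Rightarrow>\<^sub>L 'b"
  assumes "open S" "x \<in> S" and A: "continuous (at x) A"
    and inv: "\<And>x. x \<in> S \<Longrightarrow> A x o\<^sub>L B x = id_blinfun" "\<And>x. x \<in> S \<Longrightarrow> B x o\<^sub>L A x = id_blinfun"
  shows "continuous (at x) B"
proof -
  have A0: "((\<lambda>y. A y - A x) \<longlongrightarrow> 0) (at x)"
    using A by (simp add: continuous_at LIM_zero_iff)
  have eq: "B y - B x = - (B y o\<^sub>L (A y - A x) o\<^sub>L B x)" if "y \<in> S" for y
  proof (rule blinfun_eqI)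
    fix w
    have "A x (B x w) = w" "B y (A y (B x w)) = B x w"
      using inv(1)[OF assms(2)] inv(2)[OF that]
      by (metis blinfun_apply_blinfun_compose blinfun_apply_id_blinfun)+
    then show "(B y - B x) w = (- (B y o\<^sub>L (A y - A x) o\<^sub>L B x)) w"
      by (simp add: blinfun.bilinear_simps)
  qed
  \<comment> \<open>chosen such that the norms of \<open>A y - A x\<close> and \<open>B x\<close> have a product of at most one half\<close>
  let ?\<delta> = "1 / (2 * (norm (B x) + 1))"
  have "\<forall>\<^sub>F y in at x. norm (A y - A x) < ?\<delta>"
    using tendstoD[OF A0, of ?\<delta>] by (simp add: add_nonneg_pos)
  moreover have "\<forall>\<^sub>F y in at x. y \<in> S"
    using assms(1,2) by (simp add: eventually_at_topological) blast
  ultimately have "\<forall>\<^sub>F y in at x. norm (B y - B x) \<le> 2 * norm (B x) * norm (B x) * norm (A y - A x)"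
  proof eventually_elim
    case (elim y)
    let ?a = "norm (A y - A x)" and ?b = "norm (B x)"
    have n: "norm (B y - B x) \<le> norm (B y) * ?a * ?b"
      unfolding eq[OF elim(2)] norm_minus_cancel
      by (rule order_trans[OF norm_blinfun_compose mult_right_mono[OF norm_blinfun_compose]]) simp
    have "?a * ?b \<le> ?\<delta> * (?b + 1)"
      using elim(1) by (intro mult_mono) auto
    also have "\<dots> = 1/2"
    proof -
      have "norm (B x) + 1 \<noteq> 0" using norm_ge_zero[of "B x"] by linarith
      then show ?thesis by (simp add: divide_simps)
    qed
    finally have "?a * ?b \<le> 1/2" .
    then have "norm (B y) * (?a * ?b) \<le> norm (B y) * (1/2)"
      by (rule mult_left_mono) simp
    moreover have "norm (B y) \<le> norm (B x) + norm (B y - B x)"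
      by (metis add_diff_cancel_left' diff_add_cancel norm_triangle_ineq add.commute)
    ultimately have "norm (B y) \<le> 2 * ?b" using n by (simp add: mult.assoc)
    then have "norm (B y) * ?a * ?b \<le> (2 * ?b) * ?a * ?b"
      by (intro mult_right_mono) auto
    then show ?case using n by (simp add: mult_ac)
  qed
  moreover have "((\<lambda>y. 2 * norm (B x) * norm (B x) * norm (A y - A x)) \<longlongrightarrow> 0) (at x)"
    using tendsto_mult_right_zero[OF tendsto_norm_zero[OF A0]] by blast
  ultimately have "((\<lambda>y. B y - B x) \<longlongrightarrow> 0) (at x)"
    by (rule Lim_null_comparison)
  then show ?thesis by (simp add: continuous_at LIM_zero_iff)
qed

text \<open>The derivative of the inverse \<open>B\<close> is \<open>- B A' B\<close>, so each order of differentiability of \<open>B\<close>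
  reduces to the order below.\<close>

lemma k_smooth_on_inverse_blinfun:
  fixes A B :: "'a::real_normed_vector \<Rightarrow> 'b::real_normed_vector \<Rightarrow>\<^sub>L 'b"
  assumes "open S" and "k_smooth_on k S A"
    and inv: "\<And>x. x \<in> S \<Longrightarrow> A x o\<^sub>L B x = id_blinfun" "\<And>x. x \<in> S \<Longrightarrow> B x o\<^sub>L A x = id_blinfun"
  shows "k_smooth_on k S B"
  using assms(2)
proof (induction k)
  case 0
  then have "continuous (at x) A" if "x \<in> S" for x
    using assms(1) that by (simp add: continuous_on_eq_continuous_at)
  then show ?case
    using inverse_blinfun_continuous[OF assms(1) _ _ inv] assms(1)
    by (auto simp: continuous_on_eq_continuous_at)
next
  case (Suc k)
  obtain A' where A': "\<And>x. x \<in> S \<Longrightarrow> (A has_derivative A' x) (at x)"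
    "\<And>v. k_smooth_on k S (\<lambda>x. A' x v)" using k_smooth_on_SucE[OF Suc.prems] by blast
  have der: "(B has_derivative (\<lambda>v. - (B x o\<^sub>L (A' x v o\<^sub>L B x)))) (at x)" if x: "x \<in> S" for x
  proof -
    have "continuous (at x) B"
      using inverse_blinfun_continuous[OF assms(1) x has_derivative_continuous[OF A'(1)[OF x]] inv] .
    moreover have "((\<lambda>y. (A y - A x) o\<^sub>L B x) has_derivative (\<lambda>v. A' x v o\<^sub>L B x)) (at x)"
      using A'(1)[OF x] by (auto intro!: derivative_eq_intros)
    ultimately have "((\<lambda>y. B y o\<^sub>L ((A y - A x) o\<^sub>L B x)) has_derivative (\<lambda>v. B x o\<^sub>L (A' x v o\<^sub>L B x))) (at x)"
      by (rule has_derivative_bilinear_at_zero[OF bounded_bilinear_blinfun_compose]) simp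
    then have "((\<lambda>y. B x - (B y o\<^sub>L ((A y - A x) o\<^sub>L B x))) has_derivative (\<lambda>v. 0 - (B x o\<^sub>L (A' x v o\<^sub>L B x)))) (at x)"
      by (intro has_derivative_diff has_derivative_const)
    then have "((\<lambda>y. B x - (B y o\<^sub>L ((A y - A x) o\<^sub>L B x))) has_derivative (\<lambda>v. - (B x o\<^sub>L (A' x v o\<^sub>L B x)))) (at x)"
      by simp
    then show ?thesis
    proof (rule has_derivative_transform_within_open[OF _ assms(1) x])
      fix y assume y: "y \<in> S"
      show "B x - (B y o\<^sub>L ((A y - A x) o\<^sub>L B x)) = B y"
      proof (rule blinfun_eqI)
        fix w
        have "A x (B x w) = w" "B y (A y (B x w)) = B x w"
          using inv(1)[OF x] inv(2)[OF y]
          by (metis blinfun_apply_blinfun_compose blinfun_apply_id_blinfun)+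
        then show "(B x - (B y o\<^sub>L ((A y - A x) o\<^sub>L B x))) w = B y w"
          by (simp add: blinfun.bilinear_simps)
      qed
    qed
  qed
  have "k_smooth_on k S B" by (rule Suc.IH[OF k_smooth_on_SucD[OF Suc.prems]])
  then show ?case
    by (intro k_smooth_on_SucI[OF assms(1) der]
        k_smooth_on_linear_comp[OF assms(1) bounded_linear_minus[OF bounded_linear_ident]]
        k_smooth_on_bilinear[OF assms(1) bounded_bilinear_blinfun_compose] A'(2))
qed

lemma smooth_on_cong:
  "open S \<Longrightarrow> (\<And>x. x \<in> S \<Longrightarrow> f x = g x) \<Longrightarrow> smooth_on S f \<Longrightarrow> smooth_on S g"
  unfolding smooth_on_def using k_smooth_on_cong by blast

lemma smooth_on_subset: "smooth_on S f \<Longrightarrow> T \<subseteq> S \<Longrightarrow> smooth_on T f"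
  unfolding smooth_on_def using k_smooth_on_subset by blast

lemma smooth_on_const: "open S \<Longrightarrow> smooth_on S (\<lambda>x. c)"
  unfolding smooth_on_def using k_smooth_on_const by blast

lemma smooth_on_bounded_linear: "bounded_linear h \<Longrightarrow> open S \<Longrightarrow> smooth_on S h"
  unfolding smooth_on_def using k_smooth_on_bounded_linear by blast

lemma smooth_on_add:
  assumes "open S" "smooth_on S f" "smooth_on S g"
  shows "smooth_on S (\<lambda>x. f x + g x)"
  using assms(2,3) k_smooth_on_add[OF assms(1), of _ f g] by (simp add: smooth_on_def)

lemma smooth_on_sum:
  assumes "open S" "\<And>i. i \<in> I \<Longrightarrow> smooth_on S (f i)"
  shows "smooth_on S (\<lambda>x. \<Sum>i\<in>I. f i x)"
  using assms(2) k_smooth_on_sum[OF assms(1), of I _ f] by (simp add: smooth_on_def)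

lemma smooth_on_bilinear:
  assumes "open S" "bounded_bilinear h" "smooth_on S f" "smooth_on S g"
  shows "smooth_on S (\<lambda>x. h (f x) (g x))"
  using assms(3,4) k_smooth_on_bilinear[OF assms(1,2), of _ f g] by (simp add: smooth_on_def)

lemma smooth_on_linear_comp:
  assumes "open S" "bounded_linear h" "smooth_on S f"
  shows "smooth_on S (\<lambda>x. h (f x))"
  using assms(3) k_smooth_on_linear_comp[OF assms(1,2), of _ f] by (simp add: smooth_on_def)

lemma smooth_on_compose:
  fixes f :: "'a::real_normed_vector \<Rightarrow> 'b::euclidean_space"
  assumes "open S" "open T" "f ` S \<subseteq> T" and "smooth_on S f" "smooth_on T g"
  shows "smooth_on S (\<lambda>x. g (f x))"
  using assms(4,5) k_smooth_on_compose[OF assms(1-3), of _ g] by (simp add: smooth_on_def)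

lemma smooth_on_has_derivative:
  assumes "smooth_on S f" "x \<in> S"
  shows "(f has_derivative frechet_derivative f (at x)) (at x)"
proof -
  have "k_smooth_on (Suc 0) S f" using assms(1) unfolding smooth_on_def by blast
  then show ?thesis using assms(2) by (simp add: frechet_derivative_works)
qed

lemma smooth_on_continuous_on: "smooth_on S f \<Longrightarrow> continuous_on S f"
  using k_smooth_on.simps(1)[of S f] unfolding smooth_on_def by blast

lemma smooth_on_frechet_derivative_const:
  assumes "smooth_on S f"
  shows "smooth_on S (\<lambda>x. frechet_derivative f (at x) v)"
  unfolding smooth_on_def
proof
  fix k
  have "k_smooth_on (Suc k) S f" using assms by (simp only: smooth_on_def)
  then show "k_smooth_on k S (\<lambda>x. frechet_derivative f (at x) v)" by simp
qed

lemma smooth_on_frechet_derivative: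
  fixes f :: "'a::euclidean_space \<Rightarrow> 'b::real_normed_vector"
  assumes "open S" "open T" and "smooth_on T f"
    and "smooth_on S p" "p ` S \<subseteq> T" and "smooth_on S X"
  shows "smooth_on S (\<lambda>x. frechet_derivative f (at (p x)) (X x))"
proof -
  have "smooth_on S (\<lambda>x. \<Sum>b\<in>Basis. (X x \<bullet> b) *\<^sub>R frechet_derivative f (at (p x)) b)"
    by (intro smooth_on_sum[OF assms(1)] smooth_on_bilinear[OF assms(1) bounded_bilinear_scaleR]
        smooth_on_linear_comp[OF assms(1) bounded_linear_inner_left] assms
        smooth_on_compose[OF assms(1,2,5,4)] smooth_on_frechet_derivative_const)
  moreover have "(\<Sum>b\<in>Basis. (X x \<bullet> b) *\<^sub>R frechet_derivative f (at (p x)) b)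
      = frechet_derivative f (at (p x)) (X x)" if "x \<in> S" for x
    using assms(3,5) that
    by (intro linear_eq_sum_Basis[symmetric] has_derivative_linear[OF smooth_on_has_derivative]) auto
  ultimately show ?thesis by (rule smooth_on_cong[OF assms(1), rotated])
qed

text \<open>The second difference of \<open>f\<close> over the parallelogram spanned by \<open>t u\<close> and \<open>t v\<close> is symmetric in
  \<open>u\<close> and \<open>v\<close>.  Two applications of the mean value theorem turn it into \<open>t\<^sup>2\<close> times a mixed second
  derivative at a nearby point, in either order; let \<open>t\<close> tend to \<open>0\<close>.\<close>

lemma second_derivative_symmetric:
  fixes f :: "'a::euclidean_space \<Rightarrow> real"
  assumes "open S" "x \<in> S" "smooth_on S f"
  shows "frechet_derivative (\<lambda>y. frechet_derivative f (at y) v) (at x) u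
       = frechet_derivative (\<lambda>y. frechet_derivative f (at y) u) (at x) v"
proof -
  define D where "D u v y = frechet_derivative (\<lambda>y. frechet_derivative f (at y) u) (at y) v" for u v y
  obtain r where r: "r > 0" "ball x r \<subseteq> S" using assms(1,2) open_contains_ball by metis
  have cont: "continuous (at x) (D u v)" for u v
    using smooth_on_continuous_on[OF smooth_on_frechet_derivative_const[OF
          smooth_on_frechet_derivative_const[OF assms(3)]], of u v] assms(1,2)
    unfolding D_def by (simp add: continuous_on_eq_continuous_at)
  have key: "\<exists>y. dist y x < e \<and> D u v y * t * t = f (x + t *\<^sub>R u + t *\<^sub>R v) - f (x + t *\<^sub>R u) - f (x + t *\<^sub>R v) + f x"
    if t: "t > 0" "t * (norm u + norm v) < e" "e \<le> r" for t e u v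
  proof -
    have inB: "dist (x + s *\<^sub>R u + q *\<^sub>R v) x < e" if "0 \<le> s" "s \<le> t" "0 \<le> q" "q \<le> t" for s q
    proof -
      have "norm (s *\<^sub>R u + q *\<^sub>R v) \<le> s * norm u + q * norm v"
        using norm_triangle_ineq[of "s *\<^sub>R u" "q *\<^sub>R v"] that by simp
      also have "\<dots> \<le> t * norm u + t * norm v"
        using that by (intro add_mono mult_right_mono) auto
      finally show ?thesis using t(2) by (simp add: dist_norm distrib_left add.assoc)
    qed
    have inS: "x + s *\<^sub>R u + q *\<^sub>R v \<in> S" if "0 \<le> s" "s \<le> t" "0 \<le> q" "q \<le> t" for s q
      using inB[OF that] t(3) r(2) by (auto simp: dist_commute subset_iff)
    let ?f' = "\<lambda>w y. frechet_derivative f (at y) w"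
    have d1: "((\<lambda>s. f (x + s *\<^sub>R u + q *\<^sub>R v)) has_real_derivative ?f' u (x + s *\<^sub>R u + q *\<^sub>R v)) (at s)"
      if "0 \<le> s" "s \<le> t" "0 \<le> q" "q \<le> t" for s q
    proof -
      have "((\<lambda>s. x + s *\<^sub>R u + q *\<^sub>R v) has_derivative (\<lambda>h. h *\<^sub>R u)) (at s)"
        by (auto intro!: derivative_eq_intros)
      from has_derivative_compose[OF this smooth_on_has_derivative[OF assms(3) inS[OF that]]]
      have "((\<lambda>s. f (x + s *\<^sub>R u + q *\<^sub>R v)) has_derivative (\<lambda>h. frechet_derivative f (at (x + s *\<^sub>R u + q *\<^sub>R v)) (h *\<^sub>R u))) (at s)" .
      then show ?thesis
        using linear_cmul[OF has_derivative_linear[OF smooth_on_has_derivative[OF assms(3) inS[OF that]]]]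
        by (simp add: has_field_derivative_def mult_commute_abs)
    qed
    have "\<exists>\<sigma>. 0 < \<sigma> \<and> \<sigma> < t \<and>
        (f (x + t *\<^sub>R u + t *\<^sub>R v) - f (x + t *\<^sub>R u + 0 *\<^sub>R v)) - (f (x + 0 *\<^sub>R u + t *\<^sub>R v) - f (x + 0 *\<^sub>R u + 0 *\<^sub>R v))
        = (t - 0) * (?f' u (x + \<sigma> *\<^sub>R u + t *\<^sub>R v) - ?f' u (x + \<sigma> *\<^sub>R u + 0 *\<^sub>R v))"
    proof (rule MVT2[OF t(1)])
      fix s assume "0 \<le> s" "s \<le> t"
      then show "((\<lambda>s. f (x + s *\<^sub>R u + t *\<^sub>R v) - f (x + s *\<^sub>R u + 0 *\<^sub>R v)) has_real_derivative
          ?f' u (x + s *\<^sub>R u + t *\<^sub>R v) - ?f' u (x + s *\<^sub>R u + 0 *\<^sub>R v)) (at s)"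
        by (intro DERIV_diff d1) (use t(1) in auto)
    qed
    then obtain \<sigma> where \<sigma>: "0 < \<sigma>" "\<sigma> < t" and 1:
        "(f (x + t *\<^sub>R u + t *\<^sub>R v) - f (x + t *\<^sub>R u)) - (f (x + t *\<^sub>R v) - f x)
        = t * (?f' u (x + \<sigma> *\<^sub>R u + t *\<^sub>R v) - ?f' u (x + \<sigma> *\<^sub>R u + 0 *\<^sub>R v))"
      by (simp only: scaleR_zero_left add_0_right diff_0_right) blast
    have d2: "((\<lambda>q. ?f' u (x + \<sigma> *\<^sub>R u + q *\<^sub>R v)) has_real_derivative D u v (x + \<sigma> *\<^sub>R u + q *\<^sub>R v)) (at q)"
      if "0 \<le> q" "q \<le> t" for q
    proof -
      have in': "x + \<sigma> *\<^sub>R u + q *\<^sub>R v \<in> S" using inS that \<sigma> by simp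
      note d = smooth_on_has_derivative[OF smooth_on_frechet_derivative_const[OF assms(3)] in', of u]
      have "((\<lambda>q. x + \<sigma> *\<^sub>R u + q *\<^sub>R v) has_derivative (\<lambda>h. h *\<^sub>R v)) (at q)"
        by (auto intro!: derivative_eq_intros)
      from has_derivative_compose[OF this d] linear_cmul[OF has_derivative_linear[OF d]]
      show ?thesis
        by (simp add: has_field_derivative_def mult_commute_abs D_def)
    qed
    have "\<exists>\<tau>. 0 < \<tau> \<and> \<tau> < t \<and> ?f' u (x + \<sigma> *\<^sub>R u + t *\<^sub>R v) - ?f' u (x + \<sigma> *\<^sub>R u + 0 *\<^sub>R v)
        = (t - 0) * D u v (x + \<sigma> *\<^sub>R u + \<tau> *\<^sub>R v)"
      by (rule MVT2[OF t(1)]) (rule d2)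
    then obtain \<tau> where \<tau>: "0 < \<tau>" "\<tau> < t" and 2: "?f' u (x + \<sigma> *\<^sub>R u + t *\<^sub>R v) - ?f' u (x + \<sigma> *\<^sub>R u + 0 *\<^sub>R v)
        = t * D u v (x + \<sigma> *\<^sub>R u + \<tau> *\<^sub>R v)"
      by (simp only: diff_0_right) blast
    show ?thesis
    proof (intro exI conjI)
      show "dist (x + \<sigma> *\<^sub>R u + \<tau> *\<^sub>R v) x < e" using \<sigma> \<tau> by (intro inB) auto
      show "D u v (x + \<sigma> *\<^sub>R u + \<tau> *\<^sub>R v) * t * t
          = f (x + t *\<^sub>R u + t *\<^sub>R v) - f (x + t *\<^sub>R u) - f (x + t *\<^sub>R v) + f x"
        using 1[unfolded 2] by (simp add: mult.commute mult.left_commute)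
    qed
  qed
  have "D u v x = D v u x"
  proof (rule ccontr)
    assume ne: "D u v x \<noteq> D v u x"
    let ?\<epsilon> = "\<bar>D u v x - D v u x\<bar> / 2"
    have "?\<epsilon> > 0" using ne by simp
    then obtain d1 d2 where d: "d1 > 0" "\<And>y. dist y x < d1 \<Longrightarrow> dist (D u v y) (D u v x) < ?\<epsilon>"
      "d2 > 0" "\<And>y. dist y x < d2 \<Longrightarrow> dist (D v u y) (D v u x) < ?\<epsilon>"
      using cont[of u v] cont[of v u] unfolding continuous_at_eps_delta by metis
    define e where "e = min r (min d1 d2)"
    define t where "t = e / (norm u + norm v + 1)"
    have e: "e > 0" "e \<le> r" using r d by (auto simp: e_def)
    have t0: "t > 0" using e by (simp add: t_def add_nonneg_pos)
    have "t * (norm u + norm v) < t * (norm u + norm v + 1)" using t0 by simp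
    also have "\<dots> = e"
    proof -
      have "norm u + norm v + 1 \<noteq> 0" using norm_ge_zero[of u] norm_ge_zero[of v] by linarith
      then show ?thesis by (simp add: t_def)
    qed
    finally have te: "t * (norm u + norm v) < e" .
    obtain y where y: "dist y x < e" "D u v y * t * t = f (x + t *\<^sub>R u + t *\<^sub>R v) - f (x + t *\<^sub>R u) - f (x + t *\<^sub>R v) + f x"
      using key[OF t0 te e(2)] by blast
    obtain z where z: "dist z x < e" "D v u z * t * t = f (x + t *\<^sub>R v + t *\<^sub>R u) - f (x + t *\<^sub>R v) - f (x + t *\<^sub>R u) + f x"
      using key[OF t0 _ e(2), of v u] te by (auto simp: add.commute)
    have "x + t *\<^sub>R v + t *\<^sub>R u = x + t *\<^sub>R u + t *\<^sub>R v" by (simp add: add_ac)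
    then have "D u v y * t * t = D v u z * t * t" using y(2) z(2) by (simp only:)
    then have "D u v y = D v u z" using t0 by simp
    moreover have "dist (D u v y) (D u v x) < ?\<epsilon>" "dist (D v u z) (D v u x) < ?\<epsilon>"
      using y z d by (auto simp: e_def)
    ultimately show False by (auto simp: dist_real_def abs_if field_simps split: if_splits)
  qed
  then show ?thesis by (simp add: D_def)
qed

section \<open>Smooth maps and directional derivatives on a subset\<close>

lemma smooth_map_onI:
  assumes "\<And>x. x \<in> M \<Longrightarrow> \<exists>U F. open U \<and> x \<in> U \<and> smooth_on U F \<and> (\<forall>y\<in>U \<inter> M. F y = f y)"
  shows "smooth_map_on M f"
  using assms by (simp add: smooth_map_on_def)

lemma smooth_map_onE:
  assumes "smooth_map_on M f" "x \<in> M"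
  obtains U F where "open U" "x \<in> U" "smooth_on U F" "\<forall>y\<in>U \<inter> M. F y = f y"
proof -
  have "\<exists>U F. open U \<and> x \<in> U \<and> smooth_on U F \<and> (\<forall>y\<in>U \<inter> M. F y = f y)"
    by (rule bspec[OF assms(1)[unfolded smooth_map_on_def] assms(2)])
  then show thesis by (elim exE conjE) (rule that)
qed

lemma smooth_extensionI:
  assumes "open U" "x \<in> U" "smooth_on U F" "\<And>y. y \<in> U \<Longrightarrow> y \<in> M \<Longrightarrow> F y = f y"
  shows "\<exists>U F. open U \<and> x \<in> U \<and> smooth_on U F \<and> (\<forall>y\<in>U \<inter> M. F y = f y)"
  by (rule exI[of _ U], rule exI[of _ F]) (use assms in simp)

lemma smooth_on_imp_smooth_map_on:
  "open U \<Longrightarrow> M \<subseteq> U \<Longrightarrow> smooth_on U f \<Longrightarrow> smooth_map_on M f"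
  by (rule smooth_map_onI, rule smooth_extensionI[of U _ f]) auto

lemma smooth_map_on_locally:
  assumes "\<And>x. x \<in> M \<Longrightarrow> \<exists>U. open U \<and> x \<in> U \<and> smooth_map_on (U \<inter> M) f"
  shows "smooth_map_on M f"
proof (rule smooth_map_onI)
  fix x assume x: "x \<in> M"
  obtain U where U: "open U" "x \<in> U" "smooth_map_on (U \<inter> M) f" using assms[OF x] by blast
  have xU: "x \<in> U \<inter> M" using U(2) x by simp
  obtain V F where V: "open V" "x \<in> V" "smooth_on V F" "\<forall>y\<in>V \<inter> (U \<inter> M). F y = f y"
    by (rule smooth_map_onE[OF U(3) xU]) (rule that)
  show "\<exists>U F. open U \<and> x \<in> U \<and> smooth_on U F \<and> (\<forall>y\<in>U \<inter> M. F y = f y)"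
    by (rule smooth_extensionI[of "U \<inter> V" _ F]) (use U V in \<open>auto intro: smooth_on_subset[OF V(3)]\<close>)
qed

lemma smooth_map_on_subset:
  assumes "smooth_map_on M f" "N \<subseteq> M"
  shows "smooth_map_on N f"
proof (rule smooth_map_onI)
  fix x assume "x \<in> N"
  then have x: "x \<in> M" using assms(2) by auto
  obtain V F where V: "open V" "x \<in> V" "smooth_on V F" "\<forall>y\<in>V \<inter> M. F y = f y"
    by (rule smooth_map_onE[OF assms(1) x]) (rule that)
  show "\<exists>U F. open U \<and> x \<in> U \<and> smooth_on U F \<and> (\<forall>y\<in>U \<inter> N. F y = f y)"
    by (rule smooth_extensionI[OF V(1-3)]) (use V(4) assms(2) in auto)
qed

lemma smooth_map_on_cong:
  assumes "smooth_map_on M f" "\<And>x. x \<in> M \<Longrightarrow> f x = g x"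
  shows "smooth_map_on M g"
proof (rule smooth_map_onI)
  fix x assume x: "x \<in> M"
  obtain V F where V: "open V" "x \<in> V" "smooth_on V F" "\<forall>y\<in>V \<inter> M. F y = f y"
    by (rule smooth_map_onE[OF assms(1) x]) (rule that)
  show "\<exists>U F. open U \<and> x \<in> U \<and> smooth_on U F \<and> (\<forall>y\<in>U \<inter> M. F y = g y)"
    by (rule smooth_extensionI[OF V(1-3)]) (use V(4) assms(2) in auto)
qed

text \<open>On an open set, where both notions apply, local smooth extensions are the map itself.\<close>

lemma smooth_map_on_open:
  assumes "open S" "smooth_map_on S f"
  shows "smooth_on S f"
  unfolding smooth_on_def
proof (intro allI k_smooth_on_locally)
  fix k x assume "x \<in> S"
  then obtain U F where U: "open U" "x \<in> U" "smooth_on U F" "\<forall>y\<in>U \<inter> S. F y = f y"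
    by (rule smooth_map_onE[OF assms(2)])
  have o: "open (U \<inter> S)" by (rule open_Int[OF U(1) assms(1)])
  have "smooth_on (U \<inter> S) f"
    by (rule smooth_on_cong[OF o _ smooth_on_subset[OF U(3)]]) (use U(4) in auto)
  then show "\<exists>U. open U \<and> x \<in> U \<and> k_smooth_on k U f"
    using o U(2) \<open>x \<in> S\<close> by (intro exI[of _ "U \<inter> S"]) (simp add: smooth_on_def)
qed

lemma smooth_map_on_const: "smooth_map_on M (\<lambda>x. c)"
  by (rule smooth_on_imp_smooth_map_on[OF open_UNIV subset_UNIV smooth_on_const[OF open_UNIV]])

lemma smooth_map_on_bounded_linear: "bounded_linear h \<Longrightarrow> smooth_map_on M h"
  by (rule smooth_on_imp_smooth_map_on[OF open_UNIV subset_UNIV smooth_on_bounded_linear[OF _ open_UNIV]])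

lemma smooth_map_on_bilinear:
  assumes "bounded_bilinear h" "smooth_map_on M f" "smooth_map_on M g"
  shows "smooth_map_on M (\<lambda>x. h (f x) (g x))"
proof (rule smooth_map_onI)
  fix x assume x: "x \<in> M"
  obtain V F where V: "open V" "x \<in> V" "smooth_on V F" "\<forall>y\<in>V \<inter> M. F y = f y"
    by (rule smooth_map_onE[OF assms(2) x]) (rule that)
  obtain W H where W: "open W" "x \<in> W" "smooth_on W H" "\<forall>y\<in>W \<inter> M. H y = g y"
    by (rule smooth_map_onE[OF assms(3) x]) (rule that)
  show "\<exists>U K. open U \<and> x \<in> U \<and> smooth_on U K \<and> (\<forall>y\<in>U \<inter> M. K y = h (f y) (g y))"
  proof (intro exI conjI)
    show VW: "open (V \<inter> W)" "x \<in> V \<inter> W" using V W by auto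
    show "smooth_on (V \<inter> W) (\<lambda>y. h (F y) (H y))"
      by (rule smooth_on_bilinear[OF VW(1) assms(1) smooth_on_subset[OF V(3)] smooth_on_subset[OF W(3)]]) auto
    show "\<forall>y\<in>(V \<inter> W) \<inter> M. h (F y) (H y) = h (f y) (g y)" using V W by auto
  qed
qed

lemma smooth_map_on_linear_comp:
  assumes "bounded_linear h" "smooth_map_on M f"
  shows "smooth_map_on M (\<lambda>x. h (f x))"
proof (rule smooth_map_onI)
  fix x assume x: "x \<in> M"
  obtain V F where V: "open V" "x \<in> V" "smooth_on V F" "\<forall>y\<in>V \<inter> M. F y = f y"
    by (rule smooth_map_onE[OF assms(2) x]) (rule that)
  show "\<exists>U K. open U \<and> x \<in> U \<and> smooth_on U K \<and> (\<forall>y\<in>U \<inter> M. K y = h (f y))"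
    by (rule smooth_extensionI[OF V(1,2) smooth_on_linear_comp[OF V(1) assms(1) V(3)]]) (simp add: V(4))
qed

lemma smooth_map_on_add:
  assumes "smooth_map_on M f" "smooth_map_on M g"
  shows "smooth_map_on M (\<lambda>x. f x + g x)"
proof (rule smooth_map_onI)
  fix x assume x: "x \<in> M"
  obtain V F where V: "open V" "x \<in> V" "smooth_on V F" "\<forall>y\<in>V \<inter> M. F y = f y"
    by (rule smooth_map_onE[OF assms(1) x]) (rule that)
  obtain W H where W: "open W" "x \<in> W" "smooth_on W H" "\<forall>y\<in>W \<inter> M. H y = g y"
    by (rule smooth_map_onE[OF assms(2) x]) (rule that)
  show "\<exists>U K. open U \<and> x \<in> U \<and> smooth_on U K \<and> (\<forall>y\<in>U \<inter> M. K y = f y + g y)"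
  proof (intro exI conjI)
    show VW: "open (V \<inter> W)" "x \<in> V \<inter> W" using V W by auto
    show "smooth_on (V \<inter> W) (\<lambda>y. F y + H y)"
      by (rule smooth_on_add[OF VW(1) smooth_on_subset[OF V(3)] smooth_on_subset[OF W(3)]]) auto
    show "\<forall>y\<in>(V \<inter> W) \<inter> M. F y + H y = f y + g y" using V W by auto
  qed
qed

lemma smooth_map_on_minus: "smooth_map_on M f \<Longrightarrow> smooth_map_on M (\<lambda>x. - f x)"
  by (rule smooth_map_on_linear_comp[OF bounded_linear_minus[OF bounded_linear_ident]])

lemma smooth_map_on_diff:
  assumes "smooth_map_on M f" "smooth_map_on M g"
  shows "smooth_map_on M (\<lambda>x. f x - g x)"
  using smooth_map_on_add[OF assms(1) smooth_map_on_minus[OF assms(2)]] by simp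

lemma smooth_map_on_sum:
  assumes "\<And>i. i \<in> I \<Longrightarrow> smooth_map_on M (f i)"
  shows "smooth_map_on M (\<lambda>x. \<Sum>i\<in>I. f i x)"
  using assms
proof (induction I rule: infinite_finite_induct)
  case (insert i I)
  have "smooth_map_on M (\<lambda>x. f i x + (\<Sum>i\<in>I. f i x))"
    by (rule smooth_map_on_add) (use insert in auto)
  then show ?case using insert.hyps by simp
qed (simp_all add: smooth_map_on_const)

lemma smooth_map_on_Pair:
  assumes "smooth_map_on M f" "smooth_map_on M g"
  shows "smooth_map_on M (\<lambda>x. (f x, g x))"
proof -
  have "smooth_map_on M (\<lambda>x. (f x, 0) + (0, g x))"
    by (intro smooth_map_on_add smooth_map_on_linear_comp[OF _ assms(1)] smooth_map_on_linear_comp[OF _ assms(2)]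
        bounded_linear_Pair bounded_linear_zero bounded_linear_ident)
  then show ?thesis by simp
qed

lemmas smooth_map_on_blinfun_apply = smooth_map_on_bilinear[OF bounded_bilinear_blinfun_apply]
lemmas smooth_map_on_blinfun_compose = smooth_map_on_bilinear[OF bounded_bilinear_blinfun_compose]
lemmas smooth_map_on_inner = smooth_map_on_bilinear[OF bounded_bilinear_inner]
lemmas smooth_map_on_scaleR = smooth_map_on_bilinear[OF bounded_bilinear_scaleR]

lemma smooth_map_on_compose:
  fixes f :: "'a::euclidean_space \<Rightarrow> 'b::euclidean_space"
  assumes "smooth_map_on N f" "smooth_map_on M g" "f ` N \<subseteq> M"
  shows "smooth_map_on N (\<lambda>x. g (f x))"
proof (rule smooth_map_onI)
  fix x assume x: "x \<in> N"
  obtain V F where V: "open V" "x \<in> V" "smooth_on V F" "\<forall>y\<in>V \<inter> N. F y = f y"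
    by (rule smooth_map_onE[OF assms(1) x]) (rule that)
  have fx: "f x \<in> M" using assms(3) x by auto
  obtain W H where W: "open W" "f x \<in> W" "smooth_on W H" "\<forall>y\<in>W \<inter> M. H y = g y"
    by (rule smooth_map_onE[OF assms(2) fx]) (rule that)
  show "\<exists>U K. open U \<and> x \<in> U \<and> smooth_on U K \<and> (\<forall>y\<in>U \<inter> N. K y = g (f y))"
  proof (intro exI conjI)
    show o: "open (V \<inter> F -` W)"
      using continuous_on_open_vimage[OF V(1)] smooth_on_continuous_on[OF V(3)] W(1)
      by (metis Int_commute)
    show "x \<in> V \<inter> F -` W" using V(2,4) W(2) x by auto
    show "smooth_on (V \<inter> F -` W) (\<lambda>y. H (F y))"
      by (rule smooth_on_compose[OF o W(1) _ smooth_on_subset[OF V(3)] W(3)]) auto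
    show "\<forall>y\<in>(V \<inter> F -` W) \<inter> N. H (F y) = g (f y)"
      using V(4) W(4) assms(3) by fastforce
  qed
qed

text \<open>Smoothness of an operator-valued map can be tested on vectors: an operator on a
  finite-dimensional space is a finite sum of rank-one operators that depend linearly on its values.\<close>

lemma linear_blinfun_apply: "linear (blinfun_apply A)"
  by (rule bounded_linear.linear[OF blinfun.bounded_linear_right])

lemma smooth_map_on_blinfunI:
  fixes f :: "'a::euclidean_space \<Rightarrow> 'b::euclidean_space \<Rightarrow>\<^sub>L 'c::real_normed_vector"
  assumes "\<And>b. smooth_map_on M (\<lambda>x. f x b)"
  shows "smooth_map_on M f"
proof -
  let ?T = "\<lambda>b c. blinfun_scaleR_left c o\<^sub>L blinfun_inner_left (b::'b)"
  have lin: "bounded_linear (?T b :: 'c \<Rightarrow> 'b \<Rightarrow>\<^sub>L 'c)" for b :: 'b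
    by (rule bounded_linear_compose[OF bounded_bilinear.bounded_linear_left[OF bounded_bilinear_blinfun_compose]
          bounded_linear_blinfun_scaleR_left])
  have eq: "f x = (\<Sum>b\<in>Basis. ?T b (f x b))" for x
  proof (rule blinfun_eqI)
    fix w
    have "f x w = (\<Sum>b\<in>Basis. (w \<bullet> b) *\<^sub>R f x b)"
      by (rule linear_eq_sum_Basis) (rule linear_blinfun_apply)
    then show "f x w = (\<Sum>b\<in>Basis. ?T b (f x b)) w"
      by (simp add: blinfun.sum_left blinfun_inner_left.rep_eq)
  qed
  have "smooth_map_on M (\<lambda>x. \<Sum>b\<in>Basis. ?T b (f x b))"
    by (intro smooth_map_on_sum smooth_map_on_linear_comp[OF lin] assms)
  then show ?thesis by (rule smooth_map_on_cong) (rule eq[symmetric])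
qed

text \<open>A Neumann-type bound: \<open>C u = 0\<close> gives \<open>u = - B (C - A) u\<close>, which forces \<open>u = 0\<close>.\<close>

lemma invertible_blinfun_perturbation:
  fixes A :: "'a::euclidean_space \<Rightarrow>\<^sub>L 'a"
  assumes "A o\<^sub>L B = id_blinfun" "B o\<^sub>L A = id_blinfun" and C: "norm (C - A) * norm B < 1"
  shows "\<exists>D. C o\<^sub>L D = id_blinfun \<and> D o\<^sub>L C = id_blinfun"
proof -
  have "inj (blinfun_apply C)"
  proof (rule linear_injective_0[THEN iffD2, OF linear_blinfun_apply], intro allI impI)
    fix u assume u: "C u = 0"
    have "B (A u) = u" using assms(2) by (metis blinfun_apply_blinfun_compose blinfun_apply_id_blinfun)
    then have "u = - B ((C - A) u)" using u by (simp add: blinfun.bilinear_simps)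
    then have "norm u = norm (B ((C - A) u))" by (metis norm_minus_cancel)
    also have "\<dots> \<le> norm B * (norm (C - A) * norm u)"
      by (rule order_trans[OF norm_blinfun mult_left_mono[OF norm_blinfun]]) simp
    finally have "norm u \<le> (norm (C - A) * norm B) * norm u" by (simp add: mult_ac)
    with C show "u = 0"
      by (metis mult_le_cancel_right1 not_le norm_le_zero_iff norm_not_less_zero)
  qed
  then obtain g where g: "linear g" "\<And>x. g (C x) = x" "\<And>x. C (g x) = x"
    using linear_injective_isomorphism[OF linear_blinfun_apply] by blast
  have "C o\<^sub>L Blinfun g = id_blinfun \<and> Blinfun g o\<^sub>L C = id_blinfun"
    using g linear_conv_bounded_linear[of g]
    by (auto intro!: blinfun_eqI simp: bounded_linear_Blinfun_apply)
  then show ?thesis by blast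
qed

lemma inverse_operator_unique:
  assumes "A o\<^sub>L B = id_blinfun" "B o\<^sub>L A = id_blinfun"
  shows "inverse_operator A = B"
  unfolding inverse_operator_def
proof (rule the_equality)
  show "A o\<^sub>L B = id_blinfun \<and> B o\<^sub>L A = id_blinfun" using assms by simp
  fix C assume C: "A o\<^sub>L C = id_blinfun \<and> C o\<^sub>L A = id_blinfun"
  show "C = B"
  proof (rule blinfun_eqI)
    fix w
    have "A (B w) = w" "C (A (B w)) = B w"
      using assms C by (metis blinfun_apply_blinfun_compose blinfun_apply_id_blinfun)+
    then show "C w = B w" by simp
  qed
qed

text \<open>An extension of \<open>A\<close> off \<open>M\<close> need not be invertible, but by perturbation it is so near each
  point of \<open>M\<close>.\<close>

lemma smooth_map_on_inverse_operator:
  fixes A B :: "'a::euclidean_space \<Rightarrow> 'b::euclidean_space \<Rightarrow>\<^sub>L 'b"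
  assumes "smooth_map_on M A"
    and inv: "\<And>x. x \<in> M \<Longrightarrow> A x o\<^sub>L B x = id_blinfun" "\<And>x. x \<in> M \<Longrightarrow> B x o\<^sub>L A x = id_blinfun"
  shows "smooth_map_on M B"
proof (rule smooth_map_onI)
  fix x assume x: "x \<in> M"
  obtain V F where V: "open V" "x \<in> V" "smooth_on V F" "\<forall>y\<in>V \<inter> M. F y = A y"
    by (rule smooth_map_onE[OF assms(1) x]) (rule that)
  define W where "W = {y \<in> V. norm (F y - A x) * norm (B x) < 1}"
  have "continuous_on V (\<lambda>y. norm (F y - A x) * norm (B x))"
    by (intro continuous_intros smooth_on_continuous_on[OF V(3)])
  then have "open ((\<lambda>y. norm (F y - A x) * norm (B x)) -` {..<1} \<inter> V)"
    by (rule continuous_on_open_vimage[OF V(1), THEN iffD1, rule_format, OF _ open_lessThan])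
  moreover have "(\<lambda>y. norm (F y - A x) * norm (B x)) -` {..<1} \<inter> V = W" by (auto simp: W_def)
  ultimately have W: "open W" by simp
  have xW: "x \<in> W" using V x by (simp add: W_def)
  define D where "D y = inverse_operator (F y)" for y
  have D: "F y o\<^sub>L D y = id_blinfun \<and> D y o\<^sub>L F y = id_blinfun" if "y \<in> W" for y
  proof -
    have "norm (F y - A x) * norm (B x) < 1" using that by (simp add: W_def)
    from invertible_blinfun_perturbation[OF inv(1)[OF x] inv(2)[OF x] this]
    obtain C where C: "F y o\<^sub>L C = id_blinfun \<and> C o\<^sub>L F y = id_blinfun" by (elim exE)
    then have "D y = C" unfolding D_def by (intro inverse_operator_unique) simp_all
    then show ?thesis using C by simp
  qed
  have FW: "smooth_on W F" using smooth_on_subset[OF V(3)] by (auto simp: W_def)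
  have DW: "smooth_on W D"
    unfolding smooth_on_def
  proof
    fix k
    have "k_smooth_on k W F" using FW unfolding smooth_on_def by (rule spec)
    then show "k_smooth_on k W D"
      by (rule k_smooth_on_inverse_blinfun[OF W]) (use D in auto)
  qed
  show "\<exists>U F. open U \<and> x \<in> U \<and> smooth_on U F \<and> (\<forall>y\<in>U \<inter> M. F y = B y)"
  proof (rule smooth_extensionI[OF W xW DW])
    fix y assume "y \<in> W" "y \<in> M"
    then show "D y = B y"
      using V(4) inverse_operator_unique[OF inv, of y] by (simp add: W_def D_def)
  qed
qed

lemma adjoint_operator_apply: "adjoint_operator A u \<bullet> w = u \<bullet> A w"
proof -
  have "bounded_linear (adjoint (blinfun_apply A))"
    using adjoint_linear[OF linear_blinfun_apply] linear_conv_bounded_linear by blast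
  then show ?thesis
    using adjoint_works[OF linear_blinfun_apply[of A], of w u]
    by (simp add: adjoint_operator_def bounded_linear_Blinfun_apply inner_commute)
qed

lemma smooth_map_on_adjoint:
  fixes A :: "'a::euclidean_space \<Rightarrow> 'b::euclidean_space \<Rightarrow>\<^sub>L 'b"
  assumes "smooth_map_on M A"
  shows "smooth_map_on M (\<lambda>x. adjoint_operator (A x))"
proof (rule smooth_map_on_blinfunI)
  fix b
  have "smooth_map_on M (\<lambda>x. \<Sum>c\<in>Basis. (b \<bullet> A x c) *\<^sub>R c)"
    by (intro smooth_map_on_sum smooth_map_on_scaleR smooth_map_on_inner smooth_map_on_blinfun_apply
        smooth_map_on_const assms)
  then show "smooth_map_on M (\<lambda>x. adjoint_operator (A x) b)"
  proof (rule smooth_map_on_cong)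
    fix x
    have "adjoint_operator (A x) b = (\<Sum>c\<in>Basis. (adjoint_operator (A x) b \<bullet> c) *\<^sub>R c)"
      by (simp only: euclidean_representation)
    then show "(\<Sum>c\<in>Basis. (b \<bullet> A x c) *\<^sub>R c) = adjoint_operator (A x) b"
      by (simp only: adjoint_operator_apply)
  qed
qed

lemma smooth_map_on_block_operator:
  fixes A B C D :: "'a::euclidean_space \<Rightarrow> 'b::euclidean_space \<Rightarrow>\<^sub>L 'b"
  assumes "smooth_map_on N A" "smooth_map_on N B" "smooth_map_on N C" "smooth_map_on N D"
  shows "smooth_map_on N (\<lambda>p. block_operator (A p) (B p) (C p) (D p))"
proof (rule smooth_map_on_blinfunI)
  fix w :: "'b \<times> 'b"
  have "smooth_map_on N (\<lambda>p. (A p (fst w) + B p (snd w), C p (fst w) + D p (snd w)))"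
    by (intro smooth_map_on_Pair smooth_map_on_add smooth_map_on_blinfun_apply smooth_map_on_const assms)
  then show "smooth_map_on N (\<lambda>p. block_operator (A p) (B p) (C p) (D p) w)"
    by (cases w) simp
qed

lemma smooth_extension_has_derivative:
  assumes "open U" "x \<in> U" "x \<in> M" "smooth_on U F" "\<forall>y\<in>U \<inter> M. F y = f y"
  shows "(f has_derivative frechet_derivative F (at x)) (at x within M)"
proof -
  obtain e where e: "e > 0" "ball x e \<subseteq> U" using assms(1,2) by (meson open_contains_ball)
  have "(F has_derivative frechet_derivative F (at x)) (at x within M)"
    by (rule has_derivative_at_withinI[OF smooth_on_has_derivative[OF assms(4,2)]])
  then show ?thesis
    by (rule has_derivative_transform_within[OF _ e(1) assms(3)])
      (use e(2) assms(5) in \<open>auto simp: dist_commute subset_iff\<close>)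
qed

lemma smooth_map_on_has_derivative:
  assumes "smooth_map_on M f" "x \<in> M"
  shows "(f has_derivative dir_deriv M f x) (at x within M)"
proof -
  obtain V F where V: "open V" "x \<in> V" "smooth_on V F" "\<forall>y\<in>V \<inter> M. F y = f y"
    by (rule smooth_map_onE[OF assms]) (rule that)
  have "f differentiable (at x within M)"
    using smooth_extension_has_derivative[OF V(1,2) assms(2) V(3,4)] by (auto simp: differentiable_def)
  then have "(f has_derivative frechet_derivative f (at x within M)) (at x within M)"
    by (simp add: frechet_derivative_works)
  then show ?thesis by (simp add: dir_deriv_def[abs_def])
qed

lemma linear_dir_deriv:
  assumes "smooth_map_on M f" "x \<in> M"
  shows "linear (dir_deriv M f x)"
  using has_derivative_linear[OF smooth_map_on_has_derivative[OF assms]] .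

text \<open>Tangent vectors are velocities of curves in \<open>M\<close>, so the derivative of an extension in a tangent
  direction depends on the values on \<open>M\<close> alone.\<close>

lemma dir_deriv_extension:
  assumes "open U" "x \<in> U" "x \<in> M" "smooth_on U F" "\<forall>y\<in>U \<inter> M. F y = f y"
    and "v \<in> tangent_space M x"
  shows "dir_deriv M f x v = frechet_derivative F (at x) v"
  by (rule dir_deriv_eq[OF smooth_extension_has_derivative[OF assms(1-5)] assms(6)])

lemma dir_deriv_cong:
  assumes "x \<in> M" "smooth_map_on M f" "\<And>y. y \<in> M \<Longrightarrow> f y = g y" "v \<in> tangent_space M x"
  shows "dir_deriv M f x v = dir_deriv M g x v"
proof -
  have "(g has_derivative dir_deriv M f x) (at x within M)"
    using has_derivative_transform_within[OF smooth_map_on_has_derivative[OF assms(2,1)] zero_less_one assms(1)] assms(3)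
    by simp
  from dir_deriv_eq[OF this assms(4)] show ?thesis by simp
qed

lemma dir_deriv_bilinear:
  assumes "bounded_bilinear h" "smooth_map_on M f" "smooth_map_on M g" "x \<in> M" "v \<in> tangent_space M x"
  shows "dir_deriv M (\<lambda>y. h (f y) (g y)) x v = h (f x) (dir_deriv M g x v) + h (dir_deriv M f x v) (g x)"
  by (rule dir_deriv_eq[OF bounded_bilinear.FDERIV[OF assms(1)
          smooth_map_on_has_derivative[OF assms(2,4)] smooth_map_on_has_derivative[OF assms(3,4)]] assms(5)])

lemma dir_deriv_linear_comp:
  assumes "bounded_linear h" "smooth_map_on M f" "x \<in> M" "v \<in> tangent_space M x"
  shows "dir_deriv M (\<lambda>y. h (f y)) x v = h (dir_deriv M f x v)"
  by (rule dir_deriv_eq[OF bounded_linear.has_derivative[OF assms(1)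
          smooth_map_on_has_derivative[OF assms(2,3)]] assms(4)])

lemma dir_deriv_add:
  assumes "smooth_map_on M f" "smooth_map_on M g" "x \<in> M" "v \<in> tangent_space M x"
  shows "dir_deriv M (\<lambda>y. f y + g y) x v = dir_deriv M f x v + dir_deriv M g x v"
  by (rule dir_deriv_eq[OF has_derivative_add[OF
          smooth_map_on_has_derivative[OF assms(1,3)] smooth_map_on_has_derivative[OF assms(2,3)]] assms(4)])

lemma dir_deriv_bounded_linear:
  assumes "bounded_linear h" "v \<in> tangent_space M x"
  shows "dir_deriv M h x v = h v"
  by (rule dir_deriv_eq[OF bounded_linear_imp_has_derivative[OF assms(1)] assms(2)])

text \<open>The field \<open>X\<close> has to be tangent: only then does the derivative along \<open>X\<close> agree with that of a
  local extension, which is smooth.\<close>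

lemma smooth_map_on_dir_deriv:
  fixes f :: "'a::euclidean_space \<Rightarrow> 'b::real_normed_vector"
  assumes "smooth_map_on M f" "vector_field M X"
  shows "smooth_map_on M (\<lambda>x. dir_deriv M f x (X x))"
proof (rule smooth_map_onI)
  fix x assume x: "x \<in> M"
  have X: "smooth_map_on M X" "\<And>y. y \<in> M \<Longrightarrow> X y \<in> tangent_space M y"
    using assms(2) by (auto simp: vector_field_def)
  obtain V F where V: "open V" "x \<in> V" "smooth_on V F" "\<forall>y\<in>V \<inter> M. F y = f y"
    by (rule smooth_map_onE[OF assms(1) x]) (rule that)
  obtain W Y where W: "open W" "x \<in> W" "smooth_on W Y" "\<forall>y\<in>W \<inter> M. Y y = X y"
    by (rule smooth_map_onE[OF X(1) x]) (rule that)
  show "\<exists>U K. open U \<and> x \<in> U \<and> smooth_on U K \<and> (\<forall>y\<in>U \<inter> M. K y = dir_deriv M f y (X y))"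
  proof (intro exI conjI)
    show VW: "open (V \<inter> W)" "x \<in> V \<inter> W" using V W by auto
    show "smooth_on (V \<inter> W) (\<lambda>y. frechet_derivative F (at y) (Y y))"
      by (rule smooth_on_frechet_derivative[OF VW(1) V(1,3) smooth_on_bounded_linear[OF bounded_linear_ident VW(1)]
            _ smooth_on_subset[OF W(3)]]) auto
    show "\<forall>y\<in>(V \<inter> W) \<inter> M. frechet_derivative F (at y) (Y y) = dir_deriv M f y (X y)"
      using dir_deriv_extension[OF V(1) _ _ V(3,4)] X(2) W(4) by auto
  qed
qed

section \<open>Positive-definite operators and projections\<close>

definition is_projection :: "('a::euclidean_space \<Rightarrow>\<^sub>L 'a) \<Rightarrow> 'a set \<Rightarrow> ('a \<Rightarrow>\<^sub>L 'a) \<Rightarrow> bool" where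
  "is_projection A S P \<longleftrightarrow> (\<forall>w. P w \<in> S) \<and> (\<forall>w. \<forall>s\<in>S. s \<bullet> A (w - P w) = 0)"

lemma pos_def_sym: "pos_def_operator A \<Longrightarrow> A u \<bullet> w = u \<bullet> A w"
  by (simp add: pos_def_operator_def)

lemma pos_def_zero: "pos_def_operator A \<Longrightarrow> u \<bullet> A u = 0 \<Longrightarrow> u = 0"
  unfolding pos_def_operator_def by (metis less_irrefl)

lemma injective_inverse_operator:
  assumes "\<And>u. blinfun_apply A u = 0 \<Longrightarrow> u = (0::'a::euclidean_space)"
  shows "A o\<^sub>L inverse_operator A = id_blinfun" "inverse_operator A o\<^sub>L A = id_blinfun"
proof -
  have "inj (blinfun_apply A)"
    using linear_injective_0[OF linear_blinfun_apply[of A]] assms by blast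
  then obtain g where g: "linear g" "\<And>x. g (A x) = x" "\<And>x. A (g x) = x"
    using linear_injective_isomorphism[OF linear_blinfun_apply] by blast
  have *: "A o\<^sub>L Blinfun g = id_blinfun" "Blinfun g o\<^sub>L A = id_blinfun"
    using g linear_conv_bounded_linear[of g]
    by (auto intro!: blinfun_eqI simp: bounded_linear_Blinfun_apply)
  with inverse_operator_unique[OF *]
  show "A o\<^sub>L inverse_operator A = id_blinfun" "inverse_operator A o\<^sub>L A = id_blinfun" by simp_all
qed

lemma pos_def_inverse:
  assumes "pos_def_operator A"
  shows "A o\<^sub>L inverse_operator A = id_blinfun" "inverse_operator A o\<^sub>L A = id_blinfun"
proof -
  have "u = 0" if "A u = 0" for u using pos_def_zero[OF assms, of u] that by simp
  then show "A o\<^sub>L inverse_operator A = id_blinfun" "inverse_operator A o\<^sub>L A = id_blinfun"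
    by (blast intro: injective_inverse_operator)+
qed

lemma pos_def_inverse_apply [simp]:
  assumes "pos_def_operator A"
  shows "A (inverse_operator A w) = w" "inverse_operator A (A w) = w"
  using pos_def_inverse[OF assms]
  by (metis blinfun_apply_blinfun_compose blinfun_apply_id_blinfun)+

lemma is_projection_value_unique:
  assumes A: "pos_def_operator A" and S: "subspace S"
    and "p \<in> S" "\<And>s. s \<in> S \<Longrightarrow> s \<bullet> A (w - p) = 0"
    and "q \<in> S" "\<And>s. s \<in> S \<Longrightarrow> s \<bullet> A (w - q) = 0"
  shows "p = q"
proof -
  have d: "p - q \<in> S" using S assms(3,5) by (simp add: subspace_diff)
  have "(p - q) \<bullet> A (p - q) = (p - q) \<bullet> A (w - q) - (p - q) \<bullet> A (w - p)"
    by (simp add: blinfun.bilinear_simps inner_diff_right)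
  also have "\<dots> = 0" using assms(4)[OF d] assms(6)[OF d] by simp
  finally show ?thesis using pos_def_zero[OF A] by fastforce
qed

lemma projection_eqI:
  assumes A: "pos_def_operator A" and S: "subspace S" and P: "is_projection A S P"
  shows "projection A S = P"
  unfolding projection_def
proof (rule the_equality)
  show "(\<forall>w. P w \<in> S) \<and> (\<forall>w. \<forall>s\<in>S. s \<bullet> A (w - P w) = 0)" using P by (simp add: is_projection_def)
  fix Q :: "'a \<Rightarrow>\<^sub>L 'a"
  assume Q: "(\<forall>w. Q w \<in> S) \<and> (\<forall>w. \<forall>s\<in>S. s \<bullet> A (w - Q w) = 0)"
  show "Q = P"
    by (rule blinfun_eqI, rule is_projection_value_unique[OF A S])
      (use P Q in \<open>auto simp: is_projection_def\<close>)
qed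

lemma pos_def_id: "pos_def_operator id_blinfun"
  by (simp add: pos_def_operator_def)

lemma orthogonal_projection_exists:
  fixes S :: "'a::euclidean_space set"
  assumes "subspace S"
  shows "\<exists>P. is_projection id_blinfun S P"
proof -
  obtain B where B: "B \<subseteq> S" "pairwise orthogonal B" "\<And>x. x \<in> B \<Longrightarrow> norm x = 1"
      "independent B" "span B = S"
    using orthonormal_basis_subspace[OF assms] by metis
  have fB: "finite B" using B(4) by (rule independent_imp_finite)
  define f where "f w = (\<Sum>b\<in>B. (w \<bullet> b) *\<^sub>R b)" for w
  have "bounded_linear f"
    unfolding f_def by (intro bounded_linear_sum bounded_linear_compose[OF bounded_linear_scaleR_left bounded_linear_inner_left])
  then have f: "Blinfun f w = f w" for w by (simp add: bounded_linear_Blinfun_apply)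
  have fS: "f w \<in> S" for w
    unfolding f_def using B(1) assms by (intro subspace_sum subspace_scale) auto
  have fb: "b \<bullet> f w = b \<bullet> w" if b: "b \<in> B" for b w
  proof -
    have "b \<bullet> f w = (\<Sum>c\<in>B. (w \<bullet> c) * (b \<bullet> c))" by (simp add: f_def inner_sum_right)
    also have "\<dots> = (\<Sum>c\<in>B. if c = b then w \<bullet> b else 0)"
      using B(2,3) b by (intro sum.cong) (auto simp: pairwise_def orthogonal_def norm_eq_1)
    also have "\<dots> = b \<bullet> w" using fB b by (simp add: inner_commute)
    finally show ?thesis .
  qed
  have "s \<bullet> (w - f w) = 0" if "s \<in> S" for s w
  proof -
    have "s \<in> span B" using that B(5) by simp
    then show ?thesis
      by (induction rule: span_induct)
        (auto simp: subspace_def inner_add_left inner_diff_right fb)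
  qed
  then show ?thesis using fS f by (auto simp: is_projection_def intro!: exI[of _ "Blinfun f"])
qed

text \<open>A subspace is its own double orthogonal complement.  This reduces membership in \<open>L\<close> to scalar
  equations, which can be differentiated.\<close>

lemma subspace_orthogonal_char:
  fixes S :: "'a::euclidean_space set"
  assumes "subspace S" "\<And>c. (\<And>s. s \<in> S \<Longrightarrow> c \<bullet> s = 0) \<Longrightarrow> c \<bullet> w = 0"
  shows "w \<in> S"
proof -
  obtain P where P: "is_projection id_blinfun S P" using orthogonal_projection_exists[OF assms(1)] by blast
  have "(w - P w) \<bullet> s = 0" if "s \<in> S" for s
    using P that by (auto simp: is_projection_def inner_commute)
  then have "(w - P w) \<bullet> w = 0" "(w - P w) \<bullet> P w = 0"
    using assms(2) P by (auto simp: is_projection_def)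
  then have "(w - P w) \<bullet> (w - P w) = 0" by (simp add: inner_diff_right)
  then have "w = P w" by simp
  then show ?thesis using P by (metis is_projection_def)
qed

text \<open>Let \<open>P\<close> be the orthogonal projection onto a subspace \<open>L\<close> on which \<open>B\<close> is injective.  The Gram
  operator \<open>(B P)\<^sup>T A (B P)\<close> of the images under \<open>B\<close> is invertible on \<open>L\<close> only; the summand \<open>I - P\<close>
  makes it invertible on the whole space.  The projection onto \<open>B ` L\<close> can then be expressed by the
  inverse of an operator on the whole space, without choosing a basis of \<open>L\<close>, and so depends smoothly
  on \<open>A\<close> and \<open>B\<close>.\<close>

definition gram_operator :: "('a::euclidean_space \<Rightarrow>\<^sub>L 'a) \<Rightarrow> ('a \<Rightarrow>\<^sub>L 'a) \<Rightarrow> ('a \<Rightarrow>\<^sub>L 'a) \<Rightarrow> ('a \<Rightarrow>\<^sub>L 'a)" where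
  "gram_operator A B P = (adjoint_operator (B o\<^sub>L P) o\<^sub>L A o\<^sub>L (B o\<^sub>L P)) + (id_blinfun - P)"

context
  fixes A B P :: "'a::euclidean_space \<Rightarrow>\<^sub>L 'a" and L :: "'a set"
  assumes A: "pos_def_operator A" and L: "subspace L" and P: "is_projection id_blinfun L P"
    and inj: "\<And>u. u \<in> L \<Longrightarrow> B u = 0 \<Longrightarrow> u = 0"
begin

lemma gram_operator_inner:
  "u \<bullet> gram_operator A B P w = B (P u) \<bullet> A (B (P w)) + u \<bullet> (w - P w)"
  using adjoint_operator_apply[of "B o\<^sub>L P" "A (B (P w))" u]
  by (simp add: gram_operator_def blinfun.bilinear_simps inner_add_right inner_commute)

lemma gram_operator_inverse:
  "gram_operator A B P o\<^sub>L inverse_operator (gram_operator A B P) = id_blinfun"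
  "inverse_operator (gram_operator A B P) o\<^sub>L gram_operator A B P = id_blinfun"
proof -
  have "u = 0" if u: "gram_operator A B P u = 0" for u
  proof -
    have PL: "P u \<in> L" "\<And>s. s \<in> L \<Longrightarrow> s \<bullet> (u - P u) = 0" using P by (auto simp: is_projection_def)
    have "0 = B (P u) \<bullet> A (B (P u)) + u \<bullet> (u - P u)"
      using gram_operator_inner[of u u] u by simp
    also have "u \<bullet> (u - P u) = (u - P u) \<bullet> (u - P u) + P u \<bullet> (u - P u)"
      by (simp add: inner_diff_left)
    finally have "0 = B (P u) \<bullet> A (B (P u)) + (u - P u) \<bullet> (u - P u)" using PL by simp
    moreover have "B (P u) \<bullet> A (B (P u)) \<ge> 0"
      using A by (cases "B (P u) = 0") (auto simp: pos_def_operator_def less_imp_le)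
    ultimately have "B (P u) \<bullet> A (B (P u)) = 0" "(u - P u) \<bullet> (u - P u) = 0"
      using inner_ge_zero[of "u - P u"] by linarith+
    then have "B (P u) = 0" "u = P u" using pos_def_zero[OF A] by auto
    then show "u = 0" using inj PL(1) by metis
  qed
  then show "gram_operator A B P o\<^sub>L inverse_operator (gram_operator A B P) = id_blinfun"
    "inverse_operator (gram_operator A B P) o\<^sub>L gram_operator A B P = id_blinfun"
    by (blast intro: injective_inverse_operator)+
qed

text \<open>For \<open>z = S\<^sup>-\<^sup>1 (B P)\<^sup>T A w\<close>, with \<open>S\<close> the Gram operator, testing \<open>S z = (B P)\<^sup>T A w\<close> against
  \<open>s \<in> L\<close> removes the summand \<open>I - P\<close> and leaves the orthogonality of \<open>w - B P z\<close> to \<open>B s\<close>.\<close>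

lemma is_projection_gram:
  "is_projection A (B ` L)
     (B o\<^sub>L P o\<^sub>L inverse_operator (gram_operator A B P) o\<^sub>L adjoint_operator (B o\<^sub>L P) o\<^sub>L A)"
proof -
  have PL: "P u \<in> L" "\<And>s. s \<in> L \<Longrightarrow> s \<bullet> (u - P u) = 0" for u using P by (auto simp: is_projection_def)
  have PP: "P u = u" if "u \<in> L" for u
    by (rule is_projection_value_unique[OF pos_def_id L, of _ u]) (use PL that in auto)
  have "B s \<bullet> A (w - B (P (inverse_operator (gram_operator A B P) (adjoint_operator (B o\<^sub>L P) (A w))))) = 0"
    if s: "s \<in> L" for s w
  proof -
    let ?r = "adjoint_operator (B o\<^sub>L P) (A w)"
    let ?z = "inverse_operator (gram_operator A B P) ?r"
    have "gram_operator A B P ?z = ?r"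
      using gram_operator_inverse(1) by (metis blinfun_apply_blinfun_compose blinfun_apply_id_blinfun)
    then have "s \<bullet> ?r = B (P s) \<bullet> A (B (P ?z)) + s \<bullet> (?z - P ?z)"
      using gram_operator_inner[of s ?z] by simp
    moreover have "s \<bullet> ?r = B (P s) \<bullet> A w"
      using adjoint_operator_apply[of "B o\<^sub>L P" "A w" s] by (simp add: inner_commute)
    ultimately show ?thesis
      using PL(2)[OF s] PP[OF s] by (simp add: blinfun.bilinear_simps inner_diff_right)
  qed
  then show ?thesis using PL(1) by (auto simp: is_projection_def)
qed

end

lemma is_projection_projection:
  assumes "pos_def_operator A" "subspace S"
  shows "is_projection A S (projection A S)"
proof -
  obtain P where P: "is_projection id_blinfun S P" using orthogonal_projection_exists[OF assms(2)] by blast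
  have "is_projection A (blinfun_apply id_blinfun ` S)
     (id_blinfun o\<^sub>L P o\<^sub>L inverse_operator (gram_operator A id_blinfun P)
      o\<^sub>L adjoint_operator (id_blinfun o\<^sub>L P) o\<^sub>L A)"
    by (rule is_projection_gram[OF assms P]) simp
  then obtain Q where "is_projection A S Q" by auto
  then show ?thesis using projection_eqI[OF assms] by metis
qed

lemma projection_in: "pos_def_operator A \<Longrightarrow> subspace S \<Longrightarrow> projection A S w \<in> S"
  using is_projection_projection[of A S] by (simp add: is_projection_def)

lemma projection_orth:
  assumes "pos_def_operator A" "subspace S" "s \<in> S"
  shows "s \<bullet> A (projection A S w) = s \<bullet> A w"
proof -
  have "s \<bullet> A (w - projection A S w) = 0"
    using is_projection_projection[OF assms(1,2)] assms(3) by (simp add: is_projection_def)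
  then show ?thesis by (simp add: blinfun.bilinear_simps inner_diff_right)
qed

lemma projection_value_eqI:
  assumes "pos_def_operator A" "subspace S" "p \<in> S" "\<And>s. s \<in> S \<Longrightarrow> s \<bullet> A p = s \<bullet> A w"
  shows "projection A S w = p"
  by (rule is_projection_value_unique[OF assms(1,2), of _ w])
    (simp_all add: assms projection_in[OF assms(1,2)] projection_orth[OF assms(1,2)]
      blinfun.bilinear_simps inner_diff_right)

lemma projection_ident:
  assumes "pos_def_operator A" "subspace S" "s \<in> S"
  shows "projection A S s = s"
  by (rule projection_value_eqI[OF assms]) simp

text \<open>Normal vectors enter the connection as \<open>A\<^sup>-\<^sup>1 w\<close> with \<open>w\<close> orthogonal to \<open>S\<close> in the ambient inner
  product, that is, with \<open>A\<^sup>-\<^sup>1 w\<close> orthogonal to \<open>S\<close> for \<open>A\<close>.\<close>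

lemma projection_inverse_orthogonal:
  assumes "pos_def_operator A" "subspace S" "\<And>s. s \<in> S \<Longrightarrow> s \<bullet> w = 0"
  shows "projection A S (inverse_operator A w) = 0"
  by (rule projection_value_eqI[OF assms(1,2)]) (use assms in \<open>auto simp: subspace_0\<close>)

section \<open>Adapted charts and tangent spaces\<close>

text \<open>The submanifold is flattened to the subspace \<open>L\<close>; \<open>\<psi>\<close> is the inverse of \<open>\<phi>\<close>.\<close>

locale submanifold_chart =
  fixes M U V L :: "'a::euclidean_space set" and \<phi> \<psi> :: "'a \<Rightarrow> 'a"
  assumes open_U: "open U" and open_V: "open V" and homeo: "homeomorphism U V \<phi> \<psi>"
    and smooth_\<phi>: "smooth_on U \<phi>" and smooth_\<psi>: "smooth_on V \<psi>"
    and subspace_L: "subspace L" and image_M: "\<phi> ` (U \<inter> M) = V \<inter> L"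
begin

abbreviation "D\<phi> y \<equiv> frechet_derivative \<phi> (at y)"
abbreviation "D\<psi> z \<equiv> frechet_derivative \<psi> (at z)"

lemma \<phi>_in: "y \<in> U \<Longrightarrow> \<phi> y \<in> V" and \<psi>_in: "z \<in> V \<Longrightarrow> \<psi> z \<in> U"
  and \<psi>_\<phi>: "y \<in> U \<Longrightarrow> \<psi> (\<phi> y) = y" and \<phi>_\<psi>: "z \<in> V \<Longrightarrow> \<phi> (\<psi> z) = z"
  using homeo by (auto simp: homeomorphism_def)

lemma in_M_iff:
  assumes "y \<in> U"
  shows "y \<in> M \<longleftrightarrow> \<phi> y \<in> L"
proof
  assume "y \<in> M"
  then have "\<phi> y \<in> \<phi> ` (U \<inter> M)" using assms by simp
  then show "\<phi> y \<in> L" unfolding image_M by simp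
next
  assume "\<phi> y \<in> L"
  then have "\<phi> y \<in> \<phi> ` (U \<inter> M)" using assms \<phi>_in unfolding image_M by simp
  then obtain y' where "y' \<in> U \<inter> M" "\<phi> y = \<phi> y'" by auto
  then show "y \<in> M" using \<psi>_\<phi>[of y'] \<psi>_\<phi>[OF assms] by simp
qed

lemma D\<phi>: "y \<in> U \<Longrightarrow> (\<phi> has_derivative D\<phi> y) (at y)"
  by (rule smooth_on_has_derivative[OF smooth_\<phi>])

lemma D\<psi>: "z \<in> V \<Longrightarrow> (\<psi> has_derivative D\<psi> z) (at z)"
  by (rule smooth_on_has_derivative[OF smooth_\<psi>])

lemma linear_D\<phi>: "y \<in> U \<Longrightarrow> linear (D\<phi> y)" and linear_D\<psi>: "z \<in> V \<Longrightarrow> linear (D\<psi> z)"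
  by (erule has_derivative_linear[OF D\<phi>]) (erule has_derivative_linear[OF D\<psi>])

lemma D\<psi>_D\<phi>:
  assumes "y \<in> U"
  shows "D\<psi> (\<phi> y) (D\<phi> y v) = v"
proof -
  have "((\<lambda>y. \<psi> (\<phi> y)) has_derivative (\<lambda>v. D\<psi> (\<phi> y) (D\<phi> y v))) (at y)"
    by (rule has_derivative_compose[OF D\<phi>[OF assms] D\<psi>[OF \<phi>_in[OF assms]]])
  then have "((\<lambda>y. y) has_derivative (\<lambda>v. D\<psi> (\<phi> y) (D\<phi> y v))) (at y)"
    by (rule has_derivative_transform_within_open[OF _ open_U assms]) (rule \<psi>_\<phi>)
  from has_derivative_unique[OF this has_derivative_ident] show ?thesis by metis
qed

lemma D\<phi>_D\<psi>:
  assumes "z \<in> V"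
  shows "D\<phi> (\<psi> z) (D\<psi> z w) = w"
proof -
  have "((\<lambda>z. \<phi> (\<psi> z)) has_derivative (\<lambda>w. D\<phi> (\<psi> z) (D\<psi> z w))) (at z)"
    by (rule has_derivative_compose[OF D\<psi>[OF assms] D\<phi>[OF \<psi>_in[OF assms]]])
  then have "((\<lambda>z. z) has_derivative (\<lambda>w. D\<phi> (\<psi> z) (D\<psi> z w))) (at z)"
    by (rule has_derivative_transform_within_open[OF _ open_V assms]) (rule \<phi>_\<psi>)
  from has_derivative_unique[OF this has_derivative_ident] show ?thesis by metis
qed

text \<open>For \<open>c\<close> orthogonal to \<open>L\<close>, the function \<open>c \<bullet> \<phi>(\<gamma>(t))\<close> vanishes near \<open>t = 0\<close>, hence so does its
  derivative.\<close>

lemma curve_derivative_in_L: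
  assumes \<epsilon>: "\<epsilon> > 0" "\<gamma> ` {-\<epsilon><..<\<epsilon>} \<subseteq> M" and x: "\<gamma> (0::real) \<in> U"
    and v: "(\<gamma> has_vector_derivative v) (at 0)"
  shows "D\<phi> (\<gamma> 0) v \<in> L"
proof (rule subspace_orthogonal_char[OF subspace_L])
  fix c assume c: "\<And>s. s \<in> L \<Longrightarrow> c \<bullet> s = 0"
  have "(\<gamma> has_derivative (\<lambda>t. t *\<^sub>R v)) (at 0)" using v by (simp add: has_vector_derivative_def)
  from has_derivative_compose[OF this D\<phi>[OF x]]
  have h: "((\<lambda>t. c \<bullet> \<phi> (\<gamma> t)) has_derivative (\<lambda>t. c \<bullet> D\<phi> (\<gamma> 0) (t *\<^sub>R v))) (at 0)"
    by (rule has_derivative_inner_right)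
  have "continuous (at 0) \<gamma>" using v by (rule has_vector_derivative_continuous)
  moreover obtain e where e: "e > 0" "ball (\<gamma> 0) e \<subseteq> U" using x open_U open_contains_ball by metis
  ultimately obtain d where d: "d > 0" "\<And>t. dist t 0 < d \<Longrightarrow> dist (\<gamma> t) (\<gamma> 0) < e"
    unfolding continuous_at_eps_delta by metis
  have 0: "c \<bullet> \<phi> (\<gamma> t) = 0" if "dist t 0 < min d \<epsilon>" for t
  proof -
    have "\<gamma> t \<in> U" using d(2)[of t] that e(2) by (auto simp: dist_commute)
    moreover have "\<gamma> t \<in> M" using \<epsilon>(2) that by (auto simp: dist_real_def image_subset_iff abs_less_iff)
    ultimately show ?thesis using c in_M_iff by auto
  qed
  have "((\<lambda>t. 0) has_derivative (\<lambda>t. c \<bullet> D\<phi> (\<gamma> 0) (t *\<^sub>R v))) (at (0::real))"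
    by (rule has_derivative_transform_within[OF h, of "min d \<epsilon>"]) (use d \<epsilon> 0 in auto)
  from has_derivative_unique[OF this has_derivative_const]
  have "c \<bullet> D\<phi> (\<gamma> 0) (1 *\<^sub>R v) = 0" by metis
  then show "c \<bullet> D\<phi> (\<gamma> 0) v = 0" by simp
qed

text \<open>A vector \<open>v\<close> with \<open>D\<phi> x v\<close> in \<open>L\<close> is the velocity of the chart line
  \<open>t \<mapsto> \<psi>(\<phi> x + t D\<phi> x v)\<close>.\<close>

lemma tangent_space_iff:
  assumes x: "x \<in> U" "x \<in> M"
  shows "v \<in> tangent_space M x \<longleftrightarrow> D\<phi> x v \<in> L"
proof
  assume "v \<in> tangent_space M x"
  then obtain \<gamma> \<epsilon> where \<gamma>: "\<epsilon> > 0" "\<gamma> ` {-\<epsilon><..<\<epsilon>} \<subseteq> M" "\<gamma> (0::real) = x"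
      "(\<gamma> has_vector_derivative v) (at 0)"
    by (auto simp: tangent_space_def)
  show "D\<phi> x v \<in> L" using curve_derivative_in_L[OF \<gamma>(1,2) _ \<gamma>(4)] \<gamma>(3) x by simp
next
  assume v: "D\<phi> x v \<in> L"
  define w where "w = D\<phi> x v"
  define \<gamma> where "\<gamma> t = \<psi> (\<phi> x + t *\<^sub>R w)" for t
  obtain e where e: "e > 0" "ball (\<phi> x) e \<subseteq> V" using \<phi>_in[OF x(1)] open_V open_contains_ball by metis
  \<comment> \<open>the summand \<open>1\<close> avoids division by zero for \<open>w = 0\<close>\<close>
  define \<epsilon> where "\<epsilon> = e / (norm w + 1)"
  have w1: "norm w + 1 > 0" using norm_ge_zero[of w] by linarith
  have \<epsilon>: "\<epsilon> > 0" using e w1 by (simp add: \<epsilon>_def)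
  have inV: "\<phi> x + t *\<^sub>R w \<in> V" if "t \<in> {-\<epsilon><..<\<epsilon>}" for t
  proof -
    have "\<bar>t\<bar> * norm w \<le> \<bar>t\<bar> * (norm w + 1)" by (intro mult_left_mono) auto
    also have "\<dots> < \<epsilon> * (norm w + 1)" using that w1 by (intro mult_strict_right_mono) auto
    also have "\<dots> = e" using w1 by (simp add: \<epsilon>_def)
    finally show ?thesis using e(2) by (auto simp: dist_norm subset_iff)
  qed
  have inL: "\<phi> x + t *\<^sub>R w \<in> L" for t
    using v in_M_iff[OF x(1)] x(2) subspace_L by (auto simp: w_def intro: subspace_add subspace_scale)
  have oI: "open {-\<epsilon><..<\<epsilon>}" by simp
  have "smooth_on {-\<epsilon><..<\<epsilon>} (\<lambda>t. \<phi> x + t *\<^sub>R w)"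
    by (intro smooth_on_add[OF oI] smooth_on_const[OF oI] smooth_on_bounded_linear[OF bounded_linear_scaleR_left oI])
  then have "smooth_on {-\<epsilon><..<\<epsilon>} \<gamma>"
    unfolding \<gamma>_def by (rule smooth_on_compose[OF oI open_V _ _ smooth_\<psi>, rotated]) (use inV in auto)
  moreover have "\<gamma> ` {-\<epsilon><..<\<epsilon>} \<subseteq> M"
    using inV inL \<psi>_in \<phi>_\<psi> in_M_iff by (auto simp: \<gamma>_def)
  moreover have "\<gamma> 0 = x" by (simp add: \<gamma>_def \<psi>_\<phi> x)
  moreover have "(\<gamma> has_vector_derivative v) (at 0)"
  proof -
    have 1: "((\<lambda>t. \<phi> x + t *\<^sub>R w) has_derivative (\<lambda>t. t *\<^sub>R w)) (at 0)"
      by (auto intro!: derivative_eq_intros)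
    have "(\<psi> has_derivative D\<psi> (\<phi> x)) (at (\<phi> x + 0 *\<^sub>R w))" using D\<psi>[OF \<phi>_in[OF x(1)]] by simp
    from has_derivative_compose[OF 1 this]
    have "(\<gamma> has_derivative (\<lambda>t. D\<psi> (\<phi> x) (t *\<^sub>R w))) (at 0)" unfolding \<gamma>_def .
    then show ?thesis
      using linear_cmul[OF linear_D\<psi>[OF \<phi>_in[OF x(1)]]]
      by (simp add: has_vector_derivative_def w_def D\<psi>_D\<phi>[OF x(1)])
  qed
  ultimately show "v \<in> tangent_space M x"
    unfolding tangent_space_def using \<epsilon> by blast
qed

lemma tangent_space_image:
  assumes x: "x \<in> U" "x \<in> M"
  shows "tangent_space M x = D\<psi> (\<phi> x) ` L"
proof -
  have "D\<phi> x (D\<psi> (\<phi> x) w) = w" for w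
    using D\<phi>_D\<psi>[OF \<phi>_in[OF x(1)]] \<psi>_\<phi>[OF x(1)] by simp
  then show ?thesis
    using tangent_space_iff[OF x] D\<psi>_D\<phi>[OF x(1)] by (auto simp: image_iff) metis
qed

lemma subspace_tangent_space_chart:
  assumes x: "x \<in> U" "x \<in> M"
  shows "subspace (tangent_space M x)"
  unfolding tangent_space_image[OF x]
  by (rule linear_subspace_image[OF linear_D\<psi>[OF \<phi>_in[OF x(1)]] subspace_L])

end

lemma embedded_submanifold_chart:
  assumes "embedded_submanifold M" "x \<in> M"
  obtains U V L \<phi> \<psi> where "submanifold_chart M U V L \<phi> \<psi>" "x \<in> U"
proof -
  obtain d where "\<forall>x\<in>M. \<exists>U V \<phi> \<psi>. \<exists>L :: 'a set.
        open U \<and> x \<in> U \<and> open V \<and>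
        homeomorphism U V \<phi> \<psi> \<and> smooth_on U \<phi> \<and> smooth_on V \<psi> \<and>
        subspace L \<and> dim L = d \<and> \<phi> ` (U \<inter> M) = V \<inter> L"
    using assms(1) unfolding embedded_submanifold_def by (elim exE)
  from bspec[OF this assms(2)] show thesis
  proof (elim exE conjE)
    fix U V \<phi> \<psi> and L :: "'a set"
    assume a: "open U" "x \<in> U" "open V" "homeomorphism U V \<phi> \<psi>" "smooth_on U \<phi>" "smooth_on V \<psi>"
      "subspace L" "\<phi> ` (U \<inter> M) = V \<inter> L"
    have "submanifold_chart M U V L \<phi> \<psi>" by unfold_locales fact+
    then show thesis using a(2) by (rule that)
  qed
qed

lemma subspace_tangent_space:
  assumes "embedded_submanifold M" "x \<in> M"
  shows "subspace (tangent_space M x)"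
proof -
  obtain U V L \<phi> \<psi> where c: "submanifold_chart M U V L \<phi> \<psi>" "x \<in> U"
    using embedded_submanifold_chart[OF assms] by metis
  show ?thesis by (rule submanifold_chart.subspace_tangent_space_chart[OF c assms(2)])
qed

section \<open>The Levi-Civita connection of an embedded ambient structure\<close>

locale ambient_structure =
  fixes N :: "'a::euclidean_space set" and G :: "'a \<Rightarrow> 'a \<Rightarrow>\<^sub>L 'a"
  assumes ambient: "embedded_ambient_structure N G"
begin

abbreviation "T \<equiv> tangent_space N"
abbreviation "Proj \<equiv> tangent_projection N G"

lemma submanifold: "embedded_submanifold N" and smooth_G: "smooth_map_on N G"
  and pos_def_G: "p \<in> N \<Longrightarrow> pos_def_operator (G p)"
  using ambient by (auto simp: embedded_ambient_structure_def)

lemma subspace_T: "p \<in> N \<Longrightarrow> subspace (T p)"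
  by (rule subspace_tangent_space[OF submanifold])

lemma Proj_in: "p \<in> N \<Longrightarrow> Proj p w \<in> T p"
  unfolding tangent_projection_def by (intro projection_in pos_def_G subspace_T)

lemma Proj_ident: "p \<in> N \<Longrightarrow> s \<in> T p \<Longrightarrow> Proj p s = s"
  unfolding tangent_projection_def by (intro projection_ident pos_def_G subspace_T)

lemma Proj_orth: "p \<in> N \<Longrightarrow> s \<in> T p \<Longrightarrow> s \<bullet> G p (Proj p w) = s \<bullet> G p w"
  unfolding tangent_projection_def by (intro projection_orth pos_def_G subspace_T)

lemma Proj_inverse_orth: "p \<in> N \<Longrightarrow> (\<And>s. s \<in> T p \<Longrightarrow> s \<bullet> w = 0) \<Longrightarrow> Proj p (inverse_operator (G p) w) = 0"
  unfolding tangent_projection_def by (intro projection_inverse_orthogonal pos_def_G subspace_T)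

text \<open>In a chart the tangent space at \<open>y\<close> is the image of the fixed subspace \<open>L\<close> under \<open>D\<psi> (\<phi> y)\<close>, so
  \<open>is_projection_gram\<close> expresses the projection by smooth operations.\<close>

lemma smooth_Proj: "smooth_map_on N Proj"
proof (rule smooth_map_on_locally)
  fix p assume p: "p \<in> N"
  obtain U V L \<phi> \<psi> where c: "submanifold_chart N U V L \<phi> \<psi>" "p \<in> U"
    using embedded_submanifold_chart[OF submanifold p] by metis
  interpret submanifold_chart N U V L \<phi> \<psi> by (rule c(1))
  define B where "B y = Blinfun (D\<psi> (\<phi> y))" for y
  have B: "blinfun_apply (B y) = D\<psi> (\<phi> y)" if "y \<in> U" for y
    using has_derivative_bounded_linear[OF D\<psi>[OF \<phi>_in[OF that]]]
    by (simp add: B_def bounded_linear_Blinfun_apply)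
  have \<phi>UV: "\<phi> ` U \<subseteq> V" using \<phi>_in by auto
  have sB: "smooth_map_on (U \<inter> N) B"
  proof (rule smooth_map_on_blinfunI)
    fix b
    have "smooth_on U (\<lambda>y. D\<psi> (\<phi> y) b)"
      by (rule smooth_on_frechet_derivative[OF open_U open_V smooth_\<psi> smooth_\<phi> \<phi>UV smooth_on_const[OF open_U]])
    then have "smooth_map_on (U \<inter> N) (\<lambda>y. D\<psi> (\<phi> y) b)"
      by (rule smooth_on_imp_smooth_map_on[OF open_U, rotated]) simp
    then show "smooth_map_on (U \<inter> N) (\<lambda>y. B y b)"
      by (rule smooth_map_on_cong) (simp add: B)
  qed
  obtain P where P: "is_projection id_blinfun L P" using orthogonal_projection_exists[OF subspace_L] by metis
  have sG: "smooth_map_on (U \<inter> N) G" by (rule smooth_map_on_subset[OF smooth_G]) simp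
  let ?S = "\<lambda>y. gram_operator (G y) (B y) P"
  have inj: "u = 0" if "y \<in> U" "B y u = 0" for y u
  proof -
    have "D\<phi> (\<psi> (\<phi> y)) (D\<psi> (\<phi> y) u) = u" by (rule D\<phi>_D\<psi>[OF \<phi>_in[OF that(1)]])
    then show ?thesis using that(2) linear_0[OF linear_D\<phi>[OF that(1)]] by (simp add: B[OF that(1)] \<psi>_\<phi>[OF that(1)])
  qed
  have "smooth_map_on (U \<inter> N) (\<lambda>y. B y o\<^sub>L P)"
    by (intro smooth_map_on_blinfun_compose sB smooth_map_on_const)
  note sBP = this smooth_map_on_adjoint[OF this]
  have sS: "smooth_map_on (U \<inter> N) ?S"
    unfolding gram_operator_def
    by (intro smooth_map_on_add smooth_map_on_blinfun_compose sBP sG smooth_map_on_const)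
  have sSi: "smooth_map_on (U \<inter> N) (\<lambda>y. inverse_operator (?S y))"
  proof (rule smooth_map_on_inverse_operator[OF sS])
    fix y assume "y \<in> U \<inter> N"
    then have "pos_def_operator (G y)" "\<And>u. u \<in> L \<Longrightarrow> B y u = 0 \<Longrightarrow> u = 0"
      using pos_def_G inj by auto
    from gram_operator_inverse[OF this(1) subspace_L P this(2)]
    show "?S y o\<^sub>L inverse_operator (?S y) = id_blinfun" "inverse_operator (?S y) o\<^sub>L ?S y = id_blinfun"
      by auto
  qed
  have s: "smooth_map_on (U \<inter> N)
     (\<lambda>y. B y o\<^sub>L P o\<^sub>L inverse_operator (?S y) o\<^sub>L adjoint_operator (B y o\<^sub>L P) o\<^sub>L G y)"
    by (intro smooth_map_on_blinfun_compose[OF smooth_map_on_blinfun_compose[OF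
          smooth_map_on_blinfun_compose[OF sBP(1) sSi] sBP(2)] sG])
  have "smooth_map_on (U \<inter> N) Proj"
  proof (rule smooth_map_on_cong[OF s])
    fix y assume y: "y \<in> U \<inter> N"
    then have yU: "y \<in> U" and yN: "y \<in> N" by auto
    have "is_projection (G y) (blinfun_apply (B y) ` L)
        (B y o\<^sub>L P o\<^sub>L inverse_operator (?S y) o\<^sub>L adjoint_operator (B y o\<^sub>L P) o\<^sub>L G y)"
      using is_projection_gram[OF pos_def_G[OF yN] subspace_L P inj[OF yU]] .
    then have "is_projection (G y) (T y)
        (B y o\<^sub>L P o\<^sub>L inverse_operator (?S y) o\<^sub>L adjoint_operator (B y o\<^sub>L P) o\<^sub>L G y)"
      by (simp add: B[OF yU] tangent_space_image[OF yU yN])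
    from projection_eqI[OF pos_def_G[OF yN] subspace_T[OF yN] this]
    show "B y o\<^sub>L P o\<^sub>L inverse_operator (?S y) o\<^sub>L adjoint_operator (B y o\<^sub>L P) o\<^sub>L G y = Proj y"
      by (simp add: tangent_projection_def)
  qed
  then show "\<exists>U. open U \<and> p \<in> U \<and> smooth_map_on (U \<inter> N) Proj"
    using open_U c(2) by (intro exI[of _ U]) simp
qed

lemma smooth_inverse_G: "smooth_map_on N (\<lambda>p. inverse_operator (G p))"
  by (rule smooth_map_on_inverse_operator[OF smooth_G]) (simp_all add: pos_def_inverse pos_def_G)

lemma vector_field_smooth: "vector_field N X \<Longrightarrow> smooth_map_on N X"
  and vector_field_in: "vector_field N X \<Longrightarrow> p \<in> N \<Longrightarrow> X p \<in> T p"
  by (auto simp: vector_field_def)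

lemma vector_field_Proj: "smooth_map_on N w \<Longrightarrow> vector_field N (\<lambda>p. Proj p (w p))"
  by (auto simp: vector_field_def Proj_in intro!: smooth_map_on_blinfun_apply smooth_Proj)

lemma dir_deriv_apply:
  assumes "smooth_map_on N A" "smooth_map_on N f" "p \<in> N" "\<xi> \<in> T p"
  shows "dir_deriv N (\<lambda>q. blinfun_apply (A q) (f q)) p \<xi> = A p (dir_deriv N f p \<xi>) + dir_deriv N A p \<xi> (f p)"
  by (rule dir_deriv_bilinear[OF bounded_bilinear_blinfun_apply assms])

text \<open>Differentiate \<open>Y = Proj Y\<close>; the normal part of \<open>D Y\<close> is thus \<open>(D Proj) Y\<close>, which involves no
  derivative of \<open>Y\<close>.\<close>

lemma dir_deriv_vector_field:
  assumes Y: "vector_field N Y" and p: "p \<in> N" and \<xi>: "\<xi> \<in> T p"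
  shows "dir_deriv N Y p \<xi> = Proj p (dir_deriv N Y p \<xi>) + dir_deriv N Proj p \<xi> (Y p)"
proof -
  have "dir_deriv N Y p \<xi> = dir_deriv N (\<lambda>q. Proj q (Y q)) p \<xi>"
    by (rule dir_deriv_cong[OF p vector_field_smooth[OF Y] _ \<xi>])
      (simp add: Proj_ident vector_field_in[OF Y])
  also have "\<dots> = Proj p (dir_deriv N Y p \<xi>) + dir_deriv N Proj p \<xi> (Y p)"
    by (rule dir_deriv_apply[OF smooth_Proj vector_field_smooth[OF Y] p \<xi>])
  finally show ?thesis .
qed

lemma dir_deriv_G_sym:
  assumes p: "p \<in> N" and \<phi>: "\<phi> \<in> T p"
  shows "dir_deriv N G p \<phi> u \<bullet> w = u \<bullet> dir_deriv N G p \<phi> w"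
proof -
  have l1: "bounded_linear (\<lambda>A::'a \<Rightarrow>\<^sub>L 'a. A u \<bullet> w)"
    by (rule bounded_linear_compose[OF bounded_linear_inner_left blinfun.bounded_linear_left])
  have l2: "bounded_linear (\<lambda>A::'a \<Rightarrow>\<^sub>L 'a. u \<bullet> A w)"
    by (rule bounded_linear_compose[OF bounded_linear_inner_right blinfun.bounded_linear_left])
  have "dir_deriv N G p \<phi> u \<bullet> w = dir_deriv N (\<lambda>q. G q u \<bullet> w) p \<phi>"
    by (rule dir_deriv_linear_comp[OF l1 smooth_G p \<phi>, symmetric])
  also have "\<dots> = dir_deriv N (\<lambda>q. u \<bullet> G q w) p \<phi>"
    by (rule dir_deriv_cong[OF p smooth_map_on_linear_comp[OF l1 smooth_G] _ \<phi>])
      (rule pos_def_sym[OF pos_def_G])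
  also have "\<dots> = u \<bullet> dir_deriv N G p \<phi> w"
    by (rule dir_deriv_linear_comp[OF l2 smooth_G p \<phi>])
  finally show ?thesis .
qed

text \<open>A covector \<open>c \<circ> D\<phi>\<close> that annihilates the tangent spaces also annihilates a vector field \<open>Y\<close>
  along \<open>N\<close>; differentiating this identity expresses its value on the derivative of \<open>Y\<close> by the
  Hessian of \<open>c \<bullet> \<phi>\<close>, which is symmetric.\<close>

lemma conormal_dir_deriv:
  assumes chart: "submanifold_chart N U V L \<phi> \<psi>" and p: "p \<in> U" "p \<in> N"
    and c: "\<And>s. s \<in> L \<Longrightarrow> c \<bullet> s = 0" and Y: "vector_field N Y" and \<xi>: "\<xi> \<in> T p"
  shows "frechet_derivative (\<lambda>y. c \<bullet> \<phi> y) (at p) (dir_deriv N Y p \<xi>)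
    = - frechet_derivative (\<lambda>y. frechet_derivative (\<lambda>y. c \<bullet> \<phi> y) (at y) \<xi>) (at p) (Y p)"
proof -
  interpret submanifold_chart N U V L \<phi> \<psi> by (rule chart)
  define f where "f = (\<lambda>y. c \<bullet> \<phi> y)"
  have sf: "smooth_on U f"
    unfolding f_def by (rule smooth_on_linear_comp[OF open_U bounded_linear_inner_right smooth_\<phi>])
  have Df: "frechet_derivative f (at y) = (\<lambda>v. c \<bullet> D\<phi> y v)" if "y \<in> U" for y
    using frechet_derivative_at[OF has_derivative_inner_right[OF D\<phi>[OF that]]] by (simp add: f_def)
  define H where "H u v = frechet_derivative (\<lambda>y. frechet_derivative f (at y) u) (at p) v" for u v
  have H: "((\<lambda>y. frechet_derivative f (at y) u) has_derivative H u) (at p)" for u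
    using smooth_on_has_derivative[OF smooth_on_frechet_derivative_const[OF sf] p(1), of u]
    by (simp add: H_def[abs_def])
  have Hsym: "H u v = H v u" for u v
    unfolding H_def by (rule second_derivative_symmetric[OF open_U p(1) sf])
  let ?K = "\<lambda>y. \<Sum>b\<in>Basis. (Y y \<bullet> b) * frechet_derivative f (at y) b"
  have K0: "?K y = 0" if y: "y \<in> U" "y \<in> N" for y
  proof -
    have l: "linear (frechet_derivative f (at y))"
      by (rule has_derivative_linear[OF smooth_on_has_derivative[OF sf y(1)]])
    have "?K y = frechet_derivative f (at y) (Y y)"
      using linear_eq_sum_Basis[OF l, of "Y y"] by simp
    also have "\<dots> = 0"
      using vector_field_in[OF Y y(2)] tangent_space_iff[OF y] c by (simp add: Df[OF y(1)])
    finally show ?thesis .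
  qed
  let ?K' = "\<lambda>u. \<Sum>b\<in>Basis. (Y p \<bullet> b) * H b u + (dir_deriv N Y p u \<bullet> b) * frechet_derivative f (at p) b"
  have K: "(?K has_derivative ?K') (at p within N)"
    by (intro has_derivative_sum has_derivative_mult has_derivative_inner_left
        smooth_map_on_has_derivative[OF vector_field_smooth[OF Y] p(2)] has_derivative_at_withinI[OF H])
  obtain e where e: "e > 0" "ball p e \<subseteq> U" using p(1) open_U open_contains_ball by metis
  have "((\<lambda>y. 0) has_derivative ?K') (at p within N)"
    by (rule has_derivative_transform_within[OF K e(1) p(2)])
      (rule K0, use e(2) in \<open>auto simp: dist_commute\<close>)
  from dir_deriv_eq[OF this \<xi>] dir_deriv_eq[OF has_derivative_const \<xi>]
  have "?K' \<xi> = 0" by metis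
  moreover have "(\<Sum>b\<in>Basis. (Y p \<bullet> b) * H b \<xi>) = H \<xi> (Y p)"
    using linear_eq_sum_Basis[OF has_derivative_linear[OF H], of \<xi> "Y p"] by (simp add: Hsym[of _ \<xi>])
  moreover have "(\<Sum>b\<in>Basis. (dir_deriv N Y p \<xi> \<bullet> b) * frechet_derivative f (at p) b)
      = frechet_derivative f (at p) (dir_deriv N Y p \<xi>)"
    using linear_eq_sum_Basis[OF has_derivative_linear[OF smooth_on_has_derivative[OF sf p(1)]], of "dir_deriv N Y p \<xi>"]
    by simp
  ultimately have "H \<xi> (Y p) + frechet_derivative f (at p) (dir_deriv N Y p \<xi>) = 0"
    by (simp add: sum.distrib)
  then show ?thesis by (simp add: H_def f_def)
qed

text \<open>The Hessian of \<open>c \<bullet> \<phi>\<close> at \<open>X\<close> and \<open>Y\<close> gives the normal components of both \<open>D\<^sub>X Y\<close> and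
  \<open>D\<^sub>Y X\<close>, which therefore coincide.\<close>

lemma lie_bracket_tangent:
  assumes X: "vector_field N X" and Y: "vector_field N Y" and p: "p \<in> N"
  shows "lie_bracket N X Y p \<in> T p"
proof -
  obtain U V L \<phi> \<psi> where ch: "submanifold_chart N U V L \<phi> \<psi>" "p \<in> U"
    using embedded_submanifold_chart[OF submanifold p] by metis
  interpret submanifold_chart N U V L \<phi> \<psi> by (rule ch(1))
  have "D\<phi> p (lie_bracket N X Y p) \<in> L"
  proof (rule subspace_orthogonal_char[OF subspace_L])
    fix c assume c: "\<And>s. s \<in> L \<Longrightarrow> c \<bullet> s = 0"
    have sf: "smooth_on U (\<lambda>y. c \<bullet> \<phi> y)"
      by (rule smooth_on_linear_comp[OF open_U bounded_linear_inner_right smooth_\<phi>])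
    have Df: "frechet_derivative (\<lambda>y. c \<bullet> \<phi> y) (at p) v = c \<bullet> D\<phi> p v" for v
      using frechet_derivative_at[OF has_derivative_inner_right[OF D\<phi>[OF ch(2)], of c]] by metis
    have "c \<bullet> D\<phi> p (dir_deriv N Y p (X p)) = c \<bullet> D\<phi> p (dir_deriv N X p (Y p))"
      using conormal_dir_deriv[OF ch p c Y vector_field_in[OF X p]]
        conormal_dir_deriv[OF ch p c X vector_field_in[OF Y p]]
        second_derivative_symmetric[OF open_U ch(2) sf, of "X p" "Y p"]
      by (simp add: Df)
    then show "c \<bullet> D\<phi> p (lie_bracket N X Y p) = 0"
      by (simp add: lie_bracket_def linear_diff[OF linear_D\<phi>[OF ch(2)]] inner_diff_right)
  qed
  then show ?thesis using tangent_space_iff[OF ch(2) p] by simp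
qed

text \<open>The defining property of \<open>\<X>\<close> concerns \<open>\<phi> \<bullet> \<X>(\<xi>, \<eta>)\<close> for tangent \<open>\<phi>\<close> only.  Projecting \<open>\<phi>\<close> first makes
  the right-hand side linear in all vectors \<open>\<phi>\<close>, and this is the vector that represents it.\<close>

definition tangent_chi :: "'a \<Rightarrow> 'a \<Rightarrow> 'a \<Rightarrow> 'a" where
  "tangent_chi p \<xi> \<eta> = (\<Sum>b\<in>Basis. (\<xi> \<bullet> dir_deriv N G p (Proj p b) \<eta>) *\<^sub>R b)"

lemma is_chi_tangent_chi: "is_chi N G tangent_chi"
  unfolding is_chi_def
proof (intro ballI)
  fix p \<xi> \<eta> \<phi> assume p: "p \<in> N" and "\<xi> \<in> T p" "\<eta> \<in> T p" and \<phi>: "\<phi> \<in> T p"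
  have l: "linear (\<lambda>w. \<xi> \<bullet> dir_deriv N G p (Proj p w) \<eta>)"
    by (rule linearI) (simp_all add: linear_add[OF linear_dir_deriv[OF smooth_G p]]
        linear_cmul[OF linear_dir_deriv[OF smooth_G p]] blinfun.bilinear_simps inner_add_right)
  have "\<phi> \<bullet> tangent_chi p \<xi> \<eta> = (\<Sum>b\<in>Basis. (\<phi> \<bullet> b) *\<^sub>R (\<xi> \<bullet> dir_deriv N G p (Proj p b) \<eta>))"
    by (simp add: tangent_chi_def inner_sum_right mult.commute)
  also have "\<dots> = \<xi> \<bullet> dir_deriv N G p (Proj p \<phi>) \<eta>"
    by (rule linear_eq_sum_Basis[OF l, symmetric])
  finally show "\<phi> \<bullet> tangent_chi p \<xi> \<eta> = \<xi> \<bullet> dir_deriv N G p \<phi> \<eta>" by (simp add: Proj_ident[OF p \<phi>])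
qed

text \<open>Two choices of \<open>\<X>\<close> differ by a vector orthogonal to the tangent space, which \<open>Proj G\<^sup>-\<^sup>1\<close> kills.\<close>

lemma christoffel_ring_unique:
  assumes \<X>: "is_chi N G \<X>" and p: "p \<in> N" and \<xi>: "\<xi> \<in> T p" and \<eta>: "\<eta> \<in> T p"
  shows "christoffel_ring N G \<X> p \<xi> \<eta> = christoffel_ring N G tangent_chi p \<xi> \<eta>"
proof -
  let ?R = "\<lambda>w. Proj p (inverse_operator (G p) w)"
  have "s \<bullet> (christoffel_K N G \<X> p \<xi> \<eta> - christoffel_K N G tangent_chi p \<xi> \<eta>) = 0" if s: "s \<in> T p" for s
    using \<X> is_chi_tangent_chi p \<xi> \<eta> s
    by (simp add: is_chi_def christoffel_K_def inner_diff_right inner_add_right algebra_simps)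
  then have "?R (christoffel_K N G \<X> p \<xi> \<eta> - christoffel_K N G tangent_chi p \<xi> \<eta>) = 0"
    by (rule Proj_inverse_orth[OF p])
  then show ?thesis by (simp add: christoffel_ring_def blinfun.bilinear_simps)
qed

text \<open>The formula of the theorem, with the arguments projected first: derivatives along non-tangent
  directions have no intrinsic meaning, while a Christoffel function has to be bilinear in all ambient
  vectors and to depend smoothly on the point.\<close>

definition christoffel_value :: "'a \<Rightarrow> 'a \<Rightarrow> 'a \<Rightarrow> 'a" where
  "christoffel_value p \<xi> \<eta> = - dir_deriv N Proj p (Proj p \<xi>) (Proj p \<eta>) + christoffel_ring N G tangent_chi p (Proj p \<xi>) (Proj p \<eta>)"

definition christoffel_map :: "'a \<Rightarrow> 'a \<Rightarrow>\<^sub>L 'a \<Rightarrow>\<^sub>L 'a" where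
  "christoffel_map p = Blinfun (\<lambda>\<xi>. Blinfun (christoffel_value p \<xi>))"

lemma christoffel_value_linear:
  assumes p: "p \<in> N"
  shows "linear (christoffel_value p \<xi>)" "linear (\<lambda>\<xi>. christoffel_value p \<xi> \<eta>)"
proof -
  note simps = linear_add[OF linear_dir_deriv[OF smooth_G p]] linear_cmul[OF linear_dir_deriv[OF smooth_G p]]
    linear_add[OF linear_dir_deriv[OF smooth_Proj p]] linear_cmul[OF linear_dir_deriv[OF smooth_Proj p]]
    blinfun.bilinear_simps inner_add_right inner_add_left scaleR_add_left sum.distrib
    christoffel_value_def christoffel_ring_def christoffel_K_def tangent_chi_def
  show "linear (christoffel_value p \<xi>)"
    by (rule linearI) (simp_all add: simps algebra_simps scaleR_sum_right)
  show "linear (\<lambda>\<xi>. christoffel_value p \<xi> \<eta>)"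
    by (rule linearI) (simp_all add: simps algebra_simps scaleR_sum_right)
qed

text \<open>\<open>Blinfun f\<close> represents \<open>f\<close> only if \<open>f\<close> is bounded linear, which is known for points of \<open>N\<close>.\<close>

lemma christoffel_map_apply:
  assumes p: "p \<in> N"
  shows "christoffel_map p \<xi> \<eta> = christoffel_value p \<xi> \<eta>"
proof -
  have 1: "blinfun_apply (Blinfun (christoffel_value p \<xi>)) = christoffel_value p \<xi>" for \<xi>
    by (rule bounded_linear_Blinfun_apply[OF linear_conv_bounded_linear[THEN iffD1, OF christoffel_value_linear(1)[OF p]]])
  have "linear (\<lambda>\<xi>. Blinfun (christoffel_value p \<xi>))"
    by (rule linearI; rule blinfun_eqI)
      (simp_all add: 1 blinfun.bilinear_simps linear_add[OF christoffel_value_linear(2)[OF p]] linear_cmul[OF christoffel_value_linear(2)[OF p]])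
  then have "blinfun_apply (christoffel_map p) \<xi> = Blinfun (christoffel_value p \<xi>)"
    unfolding christoffel_map_def using linear_conv_bounded_linear by (subst bounded_linear_Blinfun_apply) auto
  then show ?thesis using 1 by simp
qed

lemma christoffel_map_tangent:
  assumes p: "p \<in> N" and "\<xi> \<in> T p" "\<eta> \<in> T p"
  shows "christoffel_map p \<xi> \<eta> = - dir_deriv N Proj p \<xi> \<eta> + christoffel_ring N G tangent_chi p \<xi> \<eta>"
  by (simp add: christoffel_map_apply[OF p] christoffel_value_def Proj_ident[OF p] assms)

lemma smooth_christoffel_map: "smooth_map_on N christoffel_map"
proof (rule smooth_map_on_blinfunI, rule smooth_map_on_blinfunI)
  fix \<xi> \<eta>
  have V: "vector_field N (\<lambda>p. Proj p w)" for w by (rule vector_field_Proj[OF smooth_map_on_const])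
  note s = smooth_map_on_dir_deriv[OF smooth_Proj V] smooth_map_on_dir_deriv[OF smooth_G V]
    vector_field_smooth[OF V]
  have "smooth_map_on N (\<lambda>p. christoffel_value p \<xi> \<eta>)"
    unfolding christoffel_value_def christoffel_ring_def christoffel_K_def tangent_chi_def
    by (intro smooth_map_on_add smooth_map_on_minus smooth_map_on_diff smooth_map_on_blinfun_apply s smooth_Proj
        smooth_inverse_G smooth_map_on_scaleR smooth_map_on_const smooth_map_on_sum smooth_map_on_inner)
  then show "smooth_map_on N (\<lambda>p. christoffel_map p \<xi> \<eta>)"
    by (rule smooth_map_on_cong) (simp add: christoffel_map_apply)
qed

definition connection :: "('a \<Rightarrow> 'a) \<Rightarrow> ('a \<Rightarrow> 'a) \<Rightarrow> 'a \<Rightarrow> 'a" where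
  "connection X Y p = dir_deriv N Y p (X p) + christoffel_map p (X p) (Y p)"

text \<open>The term \<open>- (D Proj) Y\<close> of the Christoffel function cancels the normal part of \<open>D\<^sub>X Y\<close>.\<close>

lemma connection_eq:
  assumes X: "vector_field N X" and Y: "vector_field N Y" and p: "p \<in> N"
  shows "connection X Y p = Proj p (dir_deriv N Y p (X p) + inverse_operator (G p) (christoffel_K N G tangent_chi p (X p) (Y p)))"
proof -
  have "dir_deriv N Proj p (X p) (Y p) = dir_deriv N Y p (X p) - Proj p (dir_deriv N Y p (X p))"
    using dir_deriv_vector_field[OF Y p vector_field_in[OF X p]] by (metis add_diff_cancel_left')
  then show ?thesis
    using christoffel_map_tangent[OF p vector_field_in[OF X p] vector_field_in[OF Y p]]
    by (simp add: connection_def christoffel_ring_def blinfun.bilinear_simps)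
qed

lemma vector_field_connection:
  assumes X: "vector_field N X" and Y: "vector_field N Y"
  shows "vector_field N (connection X Y)"
proof -
  have "smooth_map_on N (connection X Y)"
    unfolding connection_def[abs_def]
    by (intro smooth_map_on_add smooth_map_on_dir_deriv smooth_map_on_blinfun_apply smooth_christoffel_map
        vector_field_smooth X Y)
  then show ?thesis
    by (simp add: vector_field_def connection_eq[OF X Y] Proj_in)
qed

lemma connection_affine: "affine_connection N connection"
  unfolding affine_connection_def
proof (intro conjI allI impI ballI; (elim conjE)?)
  fix X Y assume "vector_field N X" "vector_field N Y"
  then show "vector_field N (connection X Y)" by (rule vector_field_connection)
next
  fix X X' Y p assume "vector_field N X" "vector_field N X'" and Y: "vector_field N Y" and p: "p \<in> N"
  show "connection (\<lambda>y. X y + X' y) Y p = connection X Y p + connection X' Y p"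
    by (simp add: connection_def linear_add[OF linear_dir_deriv[OF vector_field_smooth[OF Y] p]]
        blinfun.bilinear_simps)
next
  fix X Y Y' p assume X: "vector_field N X" and Y: "vector_field N Y" "vector_field N Y'" and p: "p \<in> N"
  show "connection X (\<lambda>y. Y y + Y' y) p = connection X Y p + connection X Y' p"
    using dir_deriv_add[OF vector_field_smooth[OF Y(1)] vector_field_smooth[OF Y(2)] p vector_field_in[OF X p]]
    by (simp add: connection_def blinfun.bilinear_simps)
next
  fix f :: "'a \<Rightarrow> real" and X Y p
  assume f: "smooth_map_on N f" and X: "vector_field N X" and Y: "vector_field N Y" and p: "p \<in> N"
  show "connection (\<lambda>y. f y *\<^sub>R X y) Y p = f p *\<^sub>R connection X Y p"
    by (simp add: connection_def linear_cmul[OF linear_dir_deriv[OF vector_field_smooth[OF Y] p]]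
        blinfun.bilinear_simps scaleR_add_right)
  show "connection X (\<lambda>y. f y *\<^sub>R Y y) p = dir_deriv N f p (X p) *\<^sub>R Y p + f p *\<^sub>R connection X Y p"
    using dir_deriv_bilinear[OF bounded_bilinear_scaleR f vector_field_smooth[OF Y] p vector_field_in[OF X p]]
    by (simp add: connection_def blinfun.bilinear_simps scaleR_add_right)
qed

text \<open>\<open>K(X, Y) - K(Y, X)\<close> comes from \<open>\<X>\<close> alone and is orthogonal to the tangent space, because \<open>D G\<close>
  is self-adjoint.  What remains is the projection of the Lie bracket.\<close>

lemma connection_torsion_free:
  assumes X: "vector_field N X" and Y: "vector_field N Y" and p: "p \<in> N"
  shows "connection X Y p - connection Y X p = lie_bracket N X Y p"
proof -
  note XY = vector_field_in[OF X p] vector_field_in[OF Y p]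
  let ?K = "christoffel_K N G tangent_chi p"
  have "s \<bullet> (?K (X p) (Y p) - ?K (Y p) (X p)) = 0" if s: "s \<in> T p" for s
  proof -
    have "s \<bullet> tangent_chi p (X p) (Y p) = s \<bullet> tangent_chi p (Y p) (X p)"
      using is_chi_tangent_chi XY p s dir_deriv_G_sym[OF p s, of "X p" "Y p"]
      by (simp add: is_chi_def inner_commute)
    then show ?thesis by (simp add: christoffel_K_def inner_diff_right inner_add_right)
  qed
  then have "Proj p (inverse_operator (G p) (?K (X p) (Y p) - ?K (Y p) (X p))) = 0"
    by (rule Proj_inverse_orth[OF p])
  then have "connection X Y p - connection Y X p = Proj p (lie_bracket N X Y p)"
    by (simp add: connection_eq X Y p lie_bracket_def blinfun.bilinear_simps)
  also have "\<dots> = lie_bracket N X Y p" by (rule Proj_ident[OF p lie_bracket_tangent[OF X Y p]])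
  finally show ?thesis .
qed

text \<open>In \<open>Y \<bullet> K(Z, X) + X \<bullet> K(Z, Y)\<close> the four terms with derivatives of \<open>G\<close> along \<open>X\<close> and \<open>Y\<close> cancel in
  pairs, leaving \<open>X \<bullet> (D\<^sub>Z G) Y\<close>, the term by which the product rule for \<open>X \<bullet> G Y\<close>
  differs from metric compatibility of \<open>D\<close>.\<close>

lemma connection_metric:
  assumes X: "vector_field N X" and Y: "vector_field N Y" and Z: "vector_field N Z" and p: "p \<in> N"
  shows "dir_deriv N (\<lambda>y. X y \<bullet> G y (Y y)) p (Z p)
       = connection Z X p \<bullet> G p (Y p) + X p \<bullet> G p (connection Z Y p)"
proof -
  note t = vector_field_in[OF X p] vector_field_in[OF Y p] vector_field_in[OF Z p]
  let ?K = "christoffel_K N G tangent_chi p" and ?DG = "dir_deriv N G p"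
  have K: "s \<bullet> G p (connection Z W p) = s \<bullet> G p (dir_deriv N W p (Z p)) + s \<bullet> ?K (Z p) (W p)"
    if W: "vector_field N W" and s: "s \<in> T p" for W s
    by (simp add: connection_eq[OF Z W p] Proj_orth[OF p s] blinfun.bilinear_simps inner_add_right pos_def_G[OF p])
  have K2: "2 * (s \<bullet> ?K (Z p) w) = s \<bullet> ?DG (Z p) w + s \<bullet> ?DG w (Z p) - Z p \<bullet> ?DG s w"
    if s: "s \<in> T p" and w: "w \<in> T p" for s w
    using is_chi_tangent_chi p t(3) s w
    by (simp add: is_chi_def christoffel_K_def inner_diff_right inner_add_right)
  have sum: "Y p \<bullet> ?K (Z p) (X p) + X p \<bullet> ?K (Z p) (Y p) = X p \<bullet> ?DG (Z p) (Y p)"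
    using K2[OF t(2,1)] K2[OF t(1,2)] dir_deriv_G_sym[OF p t(3), of "Y p" "X p"]
      dir_deriv_G_sym[OF p t(1), of "Y p" "Z p"] dir_deriv_G_sym[OF p t(2), of "X p" "Z p"]
    by (simp add: inner_commute)
  have "dir_deriv N (\<lambda>y. X y \<bullet> G y (Y y)) p (Z p)
      = X p \<bullet> (G p (dir_deriv N Y p (Z p)) + ?DG (Z p) (Y p)) + dir_deriv N X p (Z p) \<bullet> G p (Y p)"
    using dir_deriv_bilinear[OF bounded_bilinear_inner vector_field_smooth[OF X]
        smooth_map_on_blinfun_apply[OF smooth_G vector_field_smooth[OF Y]] p t(3)]
      dir_deriv_apply[OF smooth_G vector_field_smooth[OF Y] p t(3)] by simp
  moreover have "u \<bullet> G p w = w \<bullet> G p u" for u w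
    using pos_def_sym[OF pos_def_G[OF p], of u w] by (simp add: inner_commute)
  ultimately show ?thesis
    using K[OF X t(2)] K[OF Y t(1)] sum by (simp add: inner_add_right)
qed

lemma christoffel_function_map: "christoffel_function N G christoffel_map"
proof -
  have "levi_civita N G connection"
    unfolding levi_civita_def
    using connection_affine connection_torsion_free connection_metric by blast
  then show ?thesis
    unfolding christoffel_function_def using smooth_christoffel_map connection_def by blast
qed

lemma christoffel_operator_formula:
  "\<exists>\<Gamma>G. christoffel_function N G \<Gamma>G
          \<and> (\<exists>\<X>. is_chi N G \<X>)
          \<and> (\<forall>\<X>. is_chi N G \<X> \<longrightarrow>
               (\<forall>p\<in>N. \<forall>\<xi>\<in>T p. \<forall>\<eta>\<in>T p.
                    \<Gamma>G p \<xi> \<eta> = - (dir_deriv N Proj p \<xi>) \<eta> + christoffel_ring N G \<X> p \<xi> \<eta>))"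
proof (intro exI conjI allI impI ballI)
  show "christoffel_function N G christoffel_map" by (rule christoffel_function_map)
  show "is_chi N G tangent_chi" by (rule is_chi_tangent_chi)
  fix \<X> p \<xi> \<eta> assume "is_chi N G \<X>" "p \<in> N" "\<xi> \<in> T p" "\<eta> \<in> T p"
  then show "christoffel_map p \<xi> \<eta> = - (dir_deriv N Proj p \<xi>) \<eta> + christoffel_ring N G \<X> p \<xi> \<eta>"
    using christoffel_map_tangent christoffel_ring_unique by metis
qed

end

section \<open>The tangent bundle as a submanifold\<close>

lemma smooth_derivative_pair:
  fixes h :: "'a::euclidean_space \<Rightarrow> 'b::euclidean_space"
  assumes "open S" "smooth_on S h"
  shows "smooth_on (S \<times> UNIV) (\<lambda>p. (h (fst p), frechet_derivative h (at (fst p)) (snd p)))"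
proof -
  have o: "open (S \<times> (UNIV :: 'a set))" using assms(1) by (simp add: open_Times)
  have f: "fst ` (S \<times> (UNIV :: 'a set)) \<subseteq> S" by auto
  note fs = smooth_on_bounded_linear[OF bounded_linear_fst o] smooth_on_bounded_linear[OF bounded_linear_snd o]
  have 1: "smooth_on (S \<times> UNIV) (\<lambda>p :: 'a \<times> 'a. h (fst p))"
    by (rule smooth_on_compose[OF o assms(1) f fs(1) assms(2)])
  have 2: "smooth_on (S \<times> UNIV) (\<lambda>p. frechet_derivative h (at (fst p)) (snd p))"
    by (rule smooth_on_frechet_derivative[OF o assms fs(1) f fs(2)])
  show ?thesis
    by (rule smooth_map_on_open[OF o smooth_map_on_Pair[OF smooth_on_imp_smooth_map_on[OF o subset_refl 1]
            smooth_on_imp_smooth_map_on[OF o subset_refl 2]]])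
qed

context submanifold_chart
begin

text \<open>The tangent map of a chart.  It straightens \<open>TM\<close> to \<open>L \<times> L\<close> because \<open>D\<phi> y\<close> carries the tangent
  space at \<open>y\<close> to \<open>L\<close>.\<close>

lemma tangent_bundle_chart:
  "submanifold_chart (tangent_bundle M) (U \<times> UNIV) (V \<times> UNIV) (L \<times> L)
     (\<lambda>p. (\<phi> (fst p), D\<phi> (fst p) (snd p))) (\<lambda>p. (\<psi> (fst p), D\<psi> (fst p) (snd p)))"
proof
  show oU: "open (U \<times> (UNIV :: 'a set))" and oV: "open (V \<times> (UNIV :: 'a set))"
    using open_U open_V by (simp_all add: open_Times)
  show s1: "smooth_on (U \<times> UNIV) (\<lambda>p. (\<phi> (fst p), D\<phi> (fst p) (snd p)))"
    by (rule smooth_derivative_pair[OF open_U smooth_\<phi>])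
  show s2: "smooth_on (V \<times> UNIV) (\<lambda>p. (\<psi> (fst p), D\<psi> (fst p) (snd p)))"
    by (rule smooth_derivative_pair[OF open_V smooth_\<psi>])
  have inv: "D\<phi> y (D\<psi> (\<phi> y) w) = w" if "y \<in> U" for y w
    using D\<phi>_D\<psi>[OF \<phi>_in[OF that]] \<psi>_\<phi>[OF that] by simp
  have inv': "D\<psi> z (D\<phi> (\<psi> z) w) = w" if "z \<in> V" for z w
    using D\<psi>_D\<phi>[OF \<psi>_in[OF that]] \<phi>_\<psi>[OF that] by simp
  show "homeomorphism (U \<times> UNIV) (V \<times> UNIV) (\<lambda>p. (\<phi> (fst p), D\<phi> (fst p) (snd p)))
      (\<lambda>p. (\<psi> (fst p), D\<psi> (fst p) (snd p)))"
    by (rule homeomorphismI[OF smooth_on_continuous_on[OF s1] smooth_on_continuous_on[OF s2]])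
      (auto simp: \<phi>_in \<psi>_in \<phi>_\<psi> \<psi>_\<phi> D\<phi>_D\<psi> D\<psi>_D\<phi>)
  show "subspace (L \<times> L)" by (rule subspace_Times[OF subspace_L subspace_L])
  have "(z, w) \<in> (\<lambda>p. (\<phi> (fst p), D\<phi> (fst p) (snd p))) ` (U \<times> UNIV \<inter> tangent_bundle M)"
    if "z \<in> V" "z \<in> L" "w \<in> L" for z w
  proof (rule image_eqI)
    show "(z, w) = (\<phi> (fst (\<psi> z, D\<psi> z w)), D\<phi> (fst (\<psi> z, D\<psi> z w)) (snd (\<psi> z, D\<psi> z w)))"
      using that by (simp add: \<phi>_\<psi> D\<phi>_D\<psi>)
    show "(\<psi> z, D\<psi> z w) \<in> U \<times> UNIV \<inter> tangent_bundle M"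
      using that in_M_iff[OF \<psi>_in] tangent_space_iff[OF \<psi>_in]
      by (auto simp: tangent_bundle_def \<psi>_in \<phi>_\<psi> D\<phi>_D\<psi>)
  qed
  moreover have "\<phi> y \<in> V \<and> \<phi> y \<in> L \<and> D\<phi> y w \<in> L" if "y \<in> U" "(y, w) \<in> tangent_bundle M" for y w
    using that in_M_iff[OF that(1)] tangent_space_iff[OF that(1)] \<phi>_in[OF that(1)]
    by (auto simp: tangent_bundle_def)
  ultimately show "(\<lambda>p. (\<phi> (fst p), D\<phi> (fst p) (snd p))) ` (U \<times> UNIV \<inter> tangent_bundle M) = V \<times> UNIV \<inter> L \<times> L"
    by auto
qed

end

lemma embedded_submanifold_tangent_bundle:
  fixes M :: "'a::euclidean_space set"
  assumes "embedded_submanifold M"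
  shows "embedded_submanifold (tangent_bundle M)"
proof -
  obtain d where d: "\<forall>x\<in>M. \<exists>U V \<phi> \<psi>. \<exists>L :: 'a set.
        open U \<and> x \<in> U \<and> open V \<and>
        homeomorphism U V \<phi> \<psi> \<and> smooth_on U \<phi> \<and> smooth_on V \<psi> \<and>
        subspace L \<and> dim L = d \<and> \<phi> ` (U \<inter> M) = V \<inter> L"
    using assms unfolding embedded_submanifold_def by (elim exE)
  show ?thesis
    unfolding embedded_submanifold_def
  proof (intro exI[of _ "d + d"] ballI)
    fix p assume p: "p \<in> tangent_bundle M"
    then have "fst p \<in> M" by (auto simp: tangent_bundle_def)
    from bspec[OF d this] obtain U V \<phi> \<psi> and L :: "'a set" where
      c: "open U" "fst p \<in> U" "open V" "homeomorphism U V \<phi> \<psi>" "smooth_on U \<phi>" "smooth_on V \<psi>"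
        "subspace L" "dim L = d" "\<phi> ` (U \<inter> M) = V \<inter> L"
      by (elim exE conjE) (rule that)
    have "submanifold_chart M U V L \<phi> \<psi>" by unfold_locales (rule c)+
    then interpret chart: submanifold_chart M U V L \<phi> \<psi> .
    let ?\<Phi> = "\<lambda>p. (\<phi> (fst p), frechet_derivative \<phi> (at (fst p)) (snd p))"
    let ?\<Psi> = "\<lambda>p. (\<psi> (fst p), frechet_derivative \<psi> (at (fst p)) (snd p))"
    interpret total: submanifold_chart "tangent_bundle M" "U \<times> UNIV" "V \<times> UNIV" "L \<times> L" ?\<Phi> ?\<Psi>
      by (rule chart.tangent_bundle_chart)
    have "p \<in> U \<times> UNIV" using c(2) by (simp add: mem_Times_iff)
    moreover have "dim (L \<times> L) = d + d" using dim_Times[OF c(7) c(7)] c(8) by simp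
    ultimately show "\<exists>U V \<phi> \<psi>. \<exists>L :: ('a \<times> 'a) set.
        open U \<and> p \<in> U \<and> open V \<and>
        homeomorphism U V \<phi> \<psi> \<and> smooth_on U \<phi> \<and> smooth_on V \<psi> \<and>
        subspace L \<and> dim L = d + d \<and> \<phi> ` (U \<inter> tangent_bundle M) = V \<inter> L"
      using total.open_U total.open_V total.homeo total.smooth_\<phi> total.smooth_\<psi> total.subspace_L total.image_M
      by (intro exI[of _ "U \<times> UNIV"] exI[of _ "V \<times> UNIV"] exI[of _ ?\<Phi>] exI[of _ ?\<Psi>] exI[of _ "L \<times> L"] conjI)
  qed
qed

section \<open>The natural metric on the tangent bundle\<close>

locale tangent_bundle_metric =
  fixes M :: "'a::euclidean_space set" and g :: "'a \<Rightarrow> 'a \<Rightarrow>\<^sub>L 'a" and \<Gamma> :: "'a \<Rightarrow> 'a \<Rightarrow>\<^sub>L 'a \<Rightarrow>\<^sub>L 'a"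
    and ghat :: "'a \<times> 'a \<Rightarrow> 'a \<Rightarrow>\<^sub>L 'a" and G :: "'a \<times> 'a \<Rightarrow> ('a \<times> 'a) \<Rightarrow>\<^sub>L ('a \<times> 'a)"
  assumes ambient_M: "embedded_ambient_structure M g"
    and christoffel: "christoffel_function M g \<Gamma>"
    and smooth_ghat: "smooth_map_on (tangent_bundle M) ghat"
    and pos_def_ghat: "\<And>p. p \<in> tangent_bundle M \<Longrightarrow> pos_def_operator (ghat p)"
    and G_eq: "\<And>x v. (x, v) \<in> tangent_bundle M \<Longrightarrow>
           G (x, v) =
             block_operator id_blinfun (adjoint_operator (christoffel_op \<Gamma> v x)) 0 id_blinfun
             o\<^sub>L block_operator (g x) 0 0 (ghat (x, v))
             o\<^sub>L block_operator id_blinfun 0 (christoffel_op \<Gamma> v x) id_blinfun"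
begin

sublocale base: ambient_structure M g
  by unfold_locales (rule ambient_M)

abbreviation "TM \<equiv> tangent_bundle M"

lemma in_TM: "(x, v) \<in> TM \<longleftrightarrow> x \<in> M \<and> v \<in> base.T x"
  by (simp add: tangent_bundle_def)

text \<open>The covariant derivative of the tangent field \<open>Proj \<eta>\<close> along the tangent field \<open>Proj \<xi>\<close> is
  tangent; at a point where \<open>\<xi>\<close> and \<open>\<eta>\<close> are tangent it is the vector below.\<close>

lemma christoffel_tangent:
  assumes x: "x \<in> M" and \<xi>: "\<xi> \<in> base.T x" and \<eta>: "\<eta> \<in> base.T x"
  shows "dir_deriv M base.Proj x \<xi> \<eta> + \<Gamma> x \<xi> \<eta> \<in> base.T x"
proof -
  obtain nabla where nabla: "levi_civita M g nabla"
    "\<forall>X Y. vector_field M X \<and> vector_field M Y \<longrightarrow>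
           (\<forall>x\<in>M. nabla X Y x = dir_deriv M Y x (X x) + \<Gamma> x (X x) (Y x))"
    using christoffel unfolding christoffel_function_def by (elim exE conjE) (rule that)
  define X where "X y = base.Proj y \<xi>" for y
  define Y where "Y y = base.Proj y \<eta>" for y
  have XY: "vector_field M X" "vector_field M Y"
    unfolding X_def[abs_def] Y_def[abs_def] by (rule base.vector_field_Proj[OF smooth_map_on_const])+
  have "vector_field M (nabla X Y)"
    using nabla(1) XY unfolding levi_civita_def affine_connection_def by (elim conjE) metis
  then have "nabla X Y x \<in> base.T x" using x by (rule base.vector_field_in)
  moreover have "nabla X Y x = dir_deriv M Y x (X x) + \<Gamma> x (X x) (Y x)" using nabla(2) XY x by metis
  moreover have "X x = \<xi>" "Y x = \<eta>" by (simp_all add: X_def Y_def base.Proj_ident x \<xi> \<eta>)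
  moreover have "dir_deriv M Y x \<xi> = dir_deriv M base.Proj x \<xi> \<eta>"
    unfolding Y_def[abs_def] by (rule dir_deriv_linear_comp[OF blinfun.bounded_linear_left base.smooth_Proj x \<xi>])
  ultimately show ?thesis by simp
qed

text \<open>Modulo \<open>T\<^sub>xM\<close>, the vector \<open>\<Gamma>(a, v)\<close> equals \<open>- (D\<^sub>a Proj) v\<close>, and \<open>(D\<^sub>a Proj) v\<close> is the normal part of the
  velocity of every curve in \<open>TM\<close> through \<open>(x, v)\<close> that lies over a curve with velocity \<open>a\<close>.\<close>

lemma tangent_space_TM:
  assumes p: "(x, v) \<in> TM"
  shows "(a, b) \<in> tangent_space TM (x, v) \<longleftrightarrow> a \<in> base.T x \<and> b + \<Gamma> x a v \<in> base.T x"
proof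
  have x: "x \<in> M" and v: "v \<in> base.T x" using p by (auto simp: in_TM)
  note T = base.subspace_T[OF x]
  {
    assume "(a, b) \<in> tangent_space TM (x, v)"
    then obtain \<gamma> \<epsilon> where \<gamma>: "\<epsilon> > 0" "smooth_on {-\<epsilon><..<\<epsilon>} \<gamma>" "\<gamma> ` {-\<epsilon><..<\<epsilon>} \<subseteq> TM" "\<gamma> (0::real) = (x, v)"
        "(\<gamma> has_vector_derivative (a, b)) (at 0)"
      by (auto simp: tangent_space_def)
    let ?I = "{-\<epsilon><..<\<epsilon>}"
    define \<alpha> where "\<alpha> t = fst (\<gamma> t)" for t
    define \<beta> where "\<beta> t = snd (\<gamma> t)" for t
    have oI: "open ?I" by simp
    have 0: "0 \<in> ?I" using \<gamma>(1) by simp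
    have d\<alpha>: "(\<alpha> has_vector_derivative a) (at 0)" and d\<beta>: "(\<beta> has_vector_derivative b) (at 0)"
      using bounded_linear.has_vector_derivative[OF bounded_linear_fst \<gamma>(5)]
        bounded_linear.has_vector_derivative[OF bounded_linear_snd \<gamma>(5)]
      by (simp_all add: \<alpha>_def[abs_def] \<beta>_def[abs_def])
    have \<alpha>M: "\<alpha> ` ?I \<subseteq> M" using \<gamma>(3) by (auto simp: \<alpha>_def tangent_bundle_def)
    have \<alpha>0: "\<alpha> 0 = x" "\<beta> 0 = v" using \<gamma>(4) by (simp_all add: \<alpha>_def \<beta>_def)
    have s\<alpha>: "smooth_on ?I \<alpha>"
      unfolding \<alpha>_def[abs_def] by (rule smooth_on_linear_comp[OF _ bounded_linear_fst \<gamma>(2)]) simp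
    have a: "a \<in> base.T x"
      unfolding tangent_space_def using \<gamma>(1) s\<alpha> \<alpha>M \<alpha>0 d\<alpha> by blast
    have "base.Proj differentiable (at x within M)"
      using smooth_map_on_has_derivative[OF base.smooth_Proj x] by (auto simp: differentiable_def)
    from dir_deriv_curve[OF this \<gamma>(1) \<alpha>M \<alpha>0(1) d\<alpha>]
    have "((\<lambda>t. base.Proj (\<alpha> t)) has_vector_derivative dir_deriv M base.Proj x a) (at 0)"
      by (simp add: comp_def)
    from bounded_bilinear.has_vector_derivative[OF bounded_bilinear_blinfun_apply this d\<beta>]
    have "((\<lambda>t. base.Proj (\<alpha> t) (\<beta> t)) has_vector_derivative base.Proj x b + dir_deriv M base.Proj x a v) (at 0)"
      by (simp add: \<alpha>0)
    moreover have "base.Proj (\<alpha> t) (\<beta> t) = \<beta> t" if "t \<in> ?I" for t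
    proof -
      have "(\<alpha> t, \<beta> t) \<in> TM" using \<gamma>(3) that by (auto simp: \<alpha>_def \<beta>_def image_subset_iff)
      then show ?thesis using base.Proj_ident by (simp add: in_TM)
    qed
    ultimately have "(\<beta> has_vector_derivative base.Proj x b + dir_deriv M base.Proj x a v) (at 0)"
      by (rule has_vector_derivative_transform_within_open[OF _ oI 0])
    then have "b = base.Proj x b + dir_deriv M base.Proj x a v"
      by (rule vector_derivative_unique_at[OF d\<beta>])
    then have "b + \<Gamma> x a v = base.Proj x b + (dir_deriv M base.Proj x a v + \<Gamma> x a v)"
      by (metis add.assoc)
    also have "\<dots> \<in> base.T x"
      by (intro subspace_add[OF T] base.Proj_in x christoffel_tangent a v)
    finally show "a \<in> base.T x \<and> b + \<Gamma> x a v \<in> base.T x" using a by simp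
  }
  {
    assume ab: "a \<in> base.T x \<and> b + \<Gamma> x a v \<in> base.T x"
    \<comment> \<open>the tangential part that the fibre component of the curve below has to contribute\<close>
    define w where "w = b - dir_deriv M base.Proj x a v"
    have "(b + \<Gamma> x a v) - (dir_deriv M base.Proj x a v + \<Gamma> x a v) \<in> base.T x"
      using ab by (intro subspace_diff[OF T] christoffel_tangent x v) auto
    then have w: "w \<in> base.T x" by (simp add: w_def)
    obtain \<gamma> \<epsilon> where \<gamma>: "\<epsilon> > 0" "smooth_on {-\<epsilon><..<\<epsilon>} \<gamma>" "\<gamma> ` {-\<epsilon><..<\<epsilon>} \<subseteq> M" "\<gamma> (0::real) = x"
        "(\<gamma> has_vector_derivative a) (at 0)"
      using ab by (auto simp: tangent_space_def)
    let ?I = "{-\<epsilon><..<\<epsilon>}"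
    define \<delta> where "\<delta> t = (\<gamma> t, base.Proj (\<gamma> t) (v + t *\<^sub>R w))" for t
    have oI: "open ?I" by simp
    have s\<gamma>: "smooth_map_on ?I \<gamma>" by (rule smooth_on_imp_smooth_map_on[OF oI subset_refl \<gamma>(2)])
    have "smooth_map_on ?I \<delta>"
      unfolding \<delta>_def[abs_def]
      by (intro smooth_map_on_Pair s\<gamma> smooth_map_on_blinfun_apply smooth_map_on_compose[OF s\<gamma> base.smooth_Proj \<gamma>(3)]
          smooth_map_on_add smooth_map_on_const smooth_map_on_bounded_linear bounded_linear_scaleR_left)
    then have s: "smooth_on ?I \<delta>" by (rule smooth_map_on_open[OF oI])
    have in_TM: "\<delta> ` ?I \<subseteq> TM"
      using \<gamma>(3) by (auto simp: \<delta>_def in_TM image_subset_iff intro!: base.Proj_in)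
    have \<delta>0: "\<delta> 0 = (x, v)" by (simp add: \<delta>_def \<gamma>(4) base.Proj_ident x v)
    have "base.Proj differentiable (at x within M)"
      using smooth_map_on_has_derivative[OF base.smooth_Proj x] by (auto simp: differentiable_def)
    from dir_deriv_curve[OF this \<gamma>(1,3,4,5)]
    have "((\<lambda>t. base.Proj (\<gamma> t)) has_vector_derivative dir_deriv M base.Proj x a) (at 0)"
      by (simp add: comp_def)
    moreover have "((\<lambda>t. v + t *\<^sub>R w) has_vector_derivative w) (at 0)"
      by (auto intro!: derivative_eq_intros)
    ultimately have "((\<lambda>t. base.Proj (\<gamma> t) (v + t *\<^sub>R w)) has_vector_derivative
        base.Proj (\<gamma> 0) w + dir_deriv M base.Proj x a (v + 0 *\<^sub>R w)) (at 0)"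
      by (rule bounded_bilinear.has_vector_derivative[OF bounded_bilinear_blinfun_apply])
    then have "((\<lambda>t. base.Proj (\<gamma> t) (v + t *\<^sub>R w)) has_vector_derivative b) (at 0)"
      by (simp add: \<gamma>(4) base.Proj_ident x w) (simp add: w_def)
    from has_vector_derivative_Pair[OF \<gamma>(5) this]
    have "(\<delta> has_vector_derivative (a, b)) (at 0)" unfolding \<delta>_def[abs_def] .
    then show "(a, b) \<in> tangent_space TM (x, v)"
      unfolding tangent_space_def using \<gamma>(1) s in_TM \<delta>0 by blast
  }
qed

lemma G_apply:
  assumes "(x, v) \<in> TM"
  shows "G (x, v) (c, d) =
    (g x c + adjoint_operator (christoffel_op \<Gamma> v x) (ghat (x, v) (d + \<Gamma> x c v)), ghat (x, v) (d + \<Gamma> x c v))"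
  by (simp add: G_eq[OF assms] add.commute)

text \<open>The shear form of \<open>G\<close>: the inner product depends on the fibre components only through
  \<open>b + \<Gamma>(a, v)\<close> and \<open>d + \<Gamma>(c, v)\<close>.\<close>

lemma G_inner:
  assumes "(x, v) \<in> TM"
  shows "(a, b) \<bullet> G (x, v) (c, d) = a \<bullet> g x c + (b + \<Gamma> x a v) \<bullet> ghat (x, v) (d + \<Gamma> x c v)"
proof -
  have "a \<bullet> adjoint_operator (christoffel_op \<Gamma> v x) z = \<Gamma> x a v \<bullet> z" for z
    using adjoint_operator_apply[of "christoffel_op \<Gamma> v x" z a] by (simp add: inner_commute)
  then show ?thesis by (simp add: G_apply[OF assms] inner_add_left inner_add_right)
qed

lemma pos_def_G:
  assumes p: "(x, v) \<in> TM"
  shows "pos_def_operator (G (x, v))"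
proof -
  have g: "pos_def_operator (g x)" and h: "pos_def_operator (ghat (x, v))"
    using base.pos_def_G pos_def_ghat p by (auto simp: in_TM)
  have "G (x, v) (a, b) \<bullet> (c, d) = (a, b) \<bullet> G (x, v) (c, d)" for a b c d
    using G_inner[OF p, of a b c d] G_inner[OF p, of c d a b] pos_def_sym[OF g] pos_def_sym[OF h]
    by (metis inner_commute)
  moreover have "0 < (a, b) \<bullet> G (x, v) (a, b)" if "(a, b) \<noteq> 0" for a b
  proof (cases "a = 0")
    case True
    then have "b \<noteq> 0" using that by (auto simp: zero_prod_def)
    then show ?thesis using h True G_inner[OF p, of a b a b] by (simp add: pos_def_operator_def blinfun.bilinear_simps)
  next
    case False
    have "0 < a \<bullet> g x a" using g False by (simp add: pos_def_operator_def)
    moreover have "0 \<le> (b + \<Gamma> x a v) \<bullet> ghat (x, v) (b + \<Gamma> x a v)"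
      using h by (cases "b + \<Gamma> x a v = 0") (auto simp: pos_def_operator_def less_imp_le)
    ultimately show ?thesis using G_inner[OF p, of a b a b] by simp
  qed
  ultimately show ?thesis by (simp add: pos_def_operator_def split_paired_all)
qed

lemma smooth_G: "smooth_map_on TM G"
proof -
  have f: "smooth_map_on TM (fst :: 'a \<times> 'a \<Rightarrow> 'a)" "smooth_map_on TM (snd :: 'a \<times> 'a \<Rightarrow> 'a)"
    by (rule smooth_map_on_bounded_linear[OF bounded_linear_fst])
      (rule smooth_map_on_bounded_linear[OF bounded_linear_snd])
  have TM_M: "fst ` TM \<subseteq> M" by (auto simp: tangent_bundle_def)
  have "smooth_map_on M \<Gamma>" using christoffel by (simp add: christoffel_function_def)
  note s\<Gamma> = smooth_map_on_compose[OF f(1) this TM_M]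
  note sg = smooth_map_on_compose[OF f(1) base.smooth_G TM_M]
  have "smooth_map_on TM (\<lambda>p. christoffel_op \<Gamma> (snd p) (fst p))"
    by (rule smooth_map_on_blinfunI)
      (simp, intro smooth_map_on_blinfun_apply s\<Gamma> f smooth_map_on_const)
  note c = this smooth_map_on_adjoint[OF this]
  have "smooth_map_on TM (\<lambda>p.
       block_operator id_blinfun (adjoint_operator (christoffel_op \<Gamma> (snd p) (fst p))) 0 id_blinfun
             o\<^sub>L block_operator (g (fst p)) 0 0 (ghat p)
             o\<^sub>L block_operator id_blinfun 0 (christoffel_op \<Gamma> (snd p) (fst p)) id_blinfun)"
    by (intro smooth_map_on_blinfun_compose smooth_map_on_block_operator smooth_map_on_const c sg smooth_ghat)
  then show ?thesis
    by (rule smooth_map_on_cong) (auto simp: G_eq)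
qed

sublocale total: ambient_structure TM G
proof
  show "embedded_ambient_structure TM G"
    unfolding embedded_ambient_structure_def
    using embedded_submanifold_tangent_bundle[OF base.submanifold] smooth_G pos_def_G
    by (auto simp: split_paired_all)
qed

lemma inverse_G:
  assumes p: "(x, v) \<in> TM"
  shows "inverse_operator (G (x, v)) =
            block_operator id_blinfun 0 (- christoffel_op \<Gamma> v x) id_blinfun
            o\<^sub>L block_operator (inverse_operator (g x)) 0 0 (inverse_operator (ghat (x, v)))
            o\<^sub>L block_operator id_blinfun (- adjoint_operator (christoffel_op \<Gamma> v x)) 0 id_blinfun"
proof -
  have g: "pos_def_operator (g x)" and h: "pos_def_operator (ghat (x, v))"
    using base.pos_def_G pos_def_ghat p by (auto simp: in_TM)
  show ?thesis
    by (rule inverse_operator_unique; rule blinfun_eqI)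
      (auto simp: split_paired_all G_eq[OF p] blinfun.bilinear_simps g h)
qed

text \<open>The candidate sends \<open>(m, t)\<close> to the pair whose shear consists of the projections of \<open>m\<close> and of
  \<open>\<Gamma>(m, v) + t\<close>; it is tangent by \<open>tangent_space_TM\<close> and orthogonal by \<open>G_inner\<close>.\<close>

lemma projection_G:
  assumes p: "(x, v) \<in> TM"
  shows "total.Proj (x, v) =
     block_operator id_blinfun 0 (- christoffel_op \<Gamma> v x) id_blinfun
     o\<^sub>L block_operator (projection (g x) (base.T x)) 0 0 (projection (ghat (x, v)) (base.T x))
     o\<^sub>L block_operator id_blinfun 0 (christoffel_op \<Gamma> v x) id_blinfun" (is "_ = ?P")
proof -
  have g: "pos_def_operator (g x)" and h: "pos_def_operator (ghat (x, v))" and x: "x \<in> M"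
    using base.pos_def_G pos_def_ghat p by (auto simp: in_TM)
  note T = base.subspace_T[OF x]
  let ?P1 = "projection (g x) (base.T x)" and ?P2 = "projection (ghat (x, v)) (base.T x)"
  have P: "?P (m, t) = (?P1 m, ?P2 (\<Gamma> x m v + t) - \<Gamma> x (?P1 m) v)" for m t
    by (simp add: blinfun.bilinear_simps)
  have "?P w \<in> total.T (x, v)" for w
    using projection_in[OF g T] projection_in[OF h T]
    by (cases w) (simp only: P tangent_space_TM[OF p] diff_add_cancel)
  moreover have "s \<bullet> G (x, v) (w - ?P w) = 0" if s: "s \<in> total.T (x, v)" for s w
  proof -
    obtain a b m t where sw: "s = (a, b)" "w = (m, t)" by (metis surj_pair)
    have ab: "a \<in> base.T x" "b + \<Gamma> x a v \<in> base.T x" using s tangent_space_TM[OF p] by (auto simp: sw)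
    let ?z = "\<Gamma> x m v + t"
    have "w - ?P w = (m - ?P1 m, t - (?P2 ?z - \<Gamma> x (?P1 m) v))"
      unfolding sw P by simp
    moreover have "t - (?P2 ?z - \<Gamma> x (?P1 m) v) + \<Gamma> x (m - ?P1 m) v = ?z - ?P2 ?z"
      by (simp add: blinfun.bilinear_simps)
    ultimately have "s \<bullet> G (x, v) (w - ?P w)
        = a \<bullet> g x (m - ?P1 m) + (b + \<Gamma> x a v) \<bullet> ghat (x, v) (?z - ?P2 ?z)"
      by (simp only: sw(1) G_inner[OF p])
    also have "\<dots> = 0"
      using is_projection_projection[OF g T] is_projection_projection[OF h T] ab
      by (simp add: is_projection_def)
    finally show ?thesis .
  qed
  ultimately have "is_projection (G (x, v)) (total.T (x, v)) ?P" by (simp only: is_projection_def) blast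
  then show ?thesis
    unfolding tangent_projection_def by (rule projection_eqI[OF pos_def_G[OF p] total.subspace_T[OF p]])
qed

lemma dir_deriv_fst: "w \<in> total.T p \<Longrightarrow> dir_deriv TM fst p w = fst w"
  by (rule dir_deriv_bounded_linear[OF bounded_linear_fst])

lemma horizontal_vertical:
  assumes p: "(x, v) \<in> TM" and d: "(\<Delta>m, \<Delta>t) \<in> total.T (x, v)"
  shows "(0, \<Delta>t + \<Gamma> x \<Delta>m v) \<in> vertical_space TM fst (x, v)"
    and "(\<Delta>m, - \<Gamma> x \<Delta>m v) \<in> total.T (x, v)"
    and "(0, \<Delta>t + \<Gamma> x \<Delta>m v) \<bullet> G (x, v) (\<Delta>m, - \<Gamma> x \<Delta>m v) = 0"
proof -
  have x: "x \<in> M" using p by (simp add: in_TM)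
  note T = base.subspace_T[OF x]
  have t: "\<Delta>m \<in> base.T x" "\<Delta>t + \<Gamma> x \<Delta>m v \<in> base.T x" using d tangent_space_TM[OF p] by auto
  then have "(0, \<Delta>t + \<Gamma> x \<Delta>m v) \<in> total.T (x, v)"
    using subspace_0[OF T] by (simp add: tangent_space_TM[OF p] blinfun.bilinear_simps)
  then show "(0, \<Delta>t + \<Gamma> x \<Delta>m v) \<in> vertical_space TM fst (x, v)"
    by (simp add: vertical_space_def dir_deriv_fst)
  show "(\<Delta>m, - \<Gamma> x \<Delta>m v) \<in> total.T (x, v)"
    using t(1) subspace_0[OF T] by (simp add: tangent_space_TM[OF p])
  show "(0, \<Delta>t + \<Gamma> x \<Delta>m v) \<bullet> G (x, v) (\<Delta>m, - \<Gamma> x \<Delta>m v) = 0"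
    by (simp add: G_inner[OF p] blinfun.bilinear_simps)
qed

text \<open>The vertical part of a horizontal vector is orthogonal to itself for \<open>ghat\<close>, hence zero.\<close>

lemma horizontal_spaceD:
  assumes p: "(x, v) \<in> TM" and h: "(c, d) \<in> horizontal_space TM G fst (x, v)"
  shows "c \<in> base.T x" "d + \<Gamma> x c v = 0"
proof -
  have t: "(c, d) \<in> total.T (x, v)"
    and o: "\<And>\<zeta>. \<zeta> \<in> vertical_space TM fst (x, v) \<Longrightarrow> \<zeta> \<bullet> G (x, v) (c, d) = 0"
    using h by (auto simp: horizontal_space_def)
  show "c \<in> base.T x" using t tangent_space_TM[OF p] by simp
  have "(0, d + \<Gamma> x c v) \<bullet> G (x, v) (c, d) = 0" by (rule o[OF horizontal_vertical(1)[OF p t]])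
  then have "(d + \<Gamma> x c v) \<bullet> ghat (x, v) (d + \<Gamma> x c v) = 0"
    by (simp add: G_inner[OF p] blinfun.bilinear_simps)
  then show "d + \<Gamma> x c v = 0" by (rule pos_def_zero[OF pos_def_ghat[OF p]])
qed

text \<open>On horizontal vectors the second summand of \<open>G_inner\<close> vanishes, so \<open>G\<close> reduces to \<open>g\<close> of the
  base components; \<open>(a, - \<Gamma>(a, v))\<close> is a tangent lift of \<open>a\<close>.\<close>

lemma submersion: "riemannian_submersion TM G M g fst"
  unfolding riemannian_submersion_def
proof (intro conjI ballI)
  show "smooth_map_on TM (fst :: 'a \<times> 'a \<Rightarrow> 'a)" by (rule smooth_map_on_bounded_linear[OF bounded_linear_fst])
  have "(x, 0) \<in> TM" if "x \<in> M" for x using subspace_0[OF base.subspace_T[OF that]] that by (simp add: in_TM)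
  then show "fst ` TM = M" by (force simp: tangent_bundle_def)
next
  fix p assume "p \<in> TM"
  then obtain x v where xv: "p = (x, v)" and p: "(x, v) \<in> TM" by (cases p) auto
  have x: "x \<in> M" using p by (simp add: in_TM)
  have "a \<in> dir_deriv TM fst p ` total.T p" if "a \<in> base.T x" for a
  proof
    show "(a, - \<Gamma> x a v) \<in> total.T p"
      using that subspace_0[OF base.subspace_T[OF x]] by (simp add: xv tangent_space_TM[OF p])
    then show "a = dir_deriv TM fst p (a, - \<Gamma> x a v)" by (simp add: dir_deriv_fst)
  qed
  moreover have "dir_deriv TM fst p w \<in> base.T x" if "w \<in> total.T p" for w
    using that tangent_space_TM[OF p] by (cases w) (simp add: dir_deriv_fst xv)
  ultimately show "dir_deriv TM fst p ` total.T p = base.T (fst p)" by (auto simp: xv)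
next
  fix p \<xi> \<eta>
  assume "p \<in> TM" and h: "\<xi> \<in> horizontal_space TM G fst p" "\<eta> \<in> horizontal_space TM G fst p"
  then obtain x v where xv: "p = (x, v)" and p: "(x, v) \<in> TM" by (cases p) auto
  obtain a b c d where e: "\<xi> = (a, b)" "\<eta> = (c, d)" by (metis surj_pair)
  have "\<xi> \<in> total.T p" "\<eta> \<in> total.T p" using h by (auto simp: horizontal_space_def)
  then have "dir_deriv TM fst p \<xi> = a" "dir_deriv TM fst p \<eta> = c" by (simp_all add: dir_deriv_fst e)
  then show "dir_deriv TM fst p \<xi> \<bullet> g (fst p) (dir_deriv TM fst p \<eta>) = \<xi> \<bullet> G p \<eta>"
    using horizontal_spaceD(2)[OF p, of c d] h by (simp add: e xv G_inner[OF p])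
qed

end

theorem theorem7p3:
  fixes M :: "'a::euclidean_space set"
    and g :: "'a \<Rightarrow> 'a \<Rightarrow>\<^sub>L 'a"
    and \<Gamma> :: "'a \<Rightarrow> 'a \<Rightarrow>\<^sub>L 'a \<Rightarrow>\<^sub>L 'a"
    and ghat :: "'a \<times> 'a \<Rightarrow> 'a \<Rightarrow>\<^sub>L 'a"
    and G :: "'a \<times> 'a \<Rightarrow> ('a \<times> 'a) \<Rightarrow>\<^sub>L ('a \<times> 'a)"
  assumes "embedded_ambient_structure M g"
    and "christoffel_function M g \<Gamma>"
    and "smooth_map_on (tangent_bundle M) ghat"
    and "\<forall>p\<in>tangent_bundle M. pos_def_operator (ghat p)"
    and "\<forall>(x, v)\<in>tangent_bundle M.
           G (x, v) =
             block_operator id_blinfun (adjoint_operator (christoffel_op \<Gamma> v x)) 0 id_blinfun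
             o\<^sub>L block_operator (g x) 0 0 (ghat (x, v))
             o\<^sub>L block_operator id_blinfun 0 (christoffel_op \<Gamma> v x) id_blinfun"
  shows
    "embedded_ambient_structure (tangent_bundle M) G
     \<and> (\<forall>(x, v)\<in>tangent_bundle M.
          inverse_operator (G (x, v)) =
            block_operator id_blinfun 0 (- christoffel_op \<Gamma> v x) id_blinfun
            o\<^sub>L block_operator (inverse_operator (g x)) 0 0 (inverse_operator (ghat (x, v)))
            o\<^sub>L block_operator id_blinfun (- adjoint_operator (christoffel_op \<Gamma> v x)) 0 id_blinfun)
     \<and> (\<forall>(x, v)\<in>tangent_bundle M.
          \<forall>(\<Delta>m, \<Delta>t)\<in>tangent_space (tangent_bundle M) (x, v).
            (0, \<Delta>t + \<Gamma> x \<Delta>m v) \<in> vertical_space (tangent_bundle M) fst (x, v)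
            \<and> (\<Delta>m, - \<Gamma> x \<Delta>m v) \<in> tangent_space (tangent_bundle M) (x, v)
            \<and> (0, \<Delta>t + \<Gamma> x \<Delta>m v) \<bullet> G (x, v) (\<Delta>m, - \<Gamma> x \<Delta>m v) = 0)
     \<and> riemannian_submersion (tangent_bundle M) G M g fst
     \<and> (\<forall>(x, v)\<in>tangent_bundle M.
          let \<Pi>g = projection (g x) (tangent_space M x);
              \<Pi>ghat = projection (ghat (x, v)) (tangent_space M x);
              \<Gamma>v = christoffel_op \<Gamma> v x;
              \<Pi>G = tangent_projection (tangent_bundle M) G (x, v)
          in \<Pi>G =
               block_operator id_blinfun 0 (- \<Gamma>v) id_blinfun
               o\<^sub>L block_operator \<Pi>g 0 0 \<Pi>ghat
               o\<^sub>L block_operator id_blinfun 0 \<Gamma>v id_blinfun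
             \<and> (\<forall>\<omega>m \<omega>t.
                  \<Pi>G (\<omega>m, \<omega>t) =
                    (\<Pi>g \<omega>m, (- (\<Gamma>v o\<^sub>L \<Pi>g) + (\<Pi>ghat o\<^sub>L \<Gamma>v)) \<omega>m + \<Pi>ghat \<omega>t)))
     \<and> (\<exists>\<Gamma>G. christoffel_function (tangent_bundle M) G \<Gamma>G
          \<and> (\<exists>\<X>. is_chi (tangent_bundle M) G \<X>)
          \<and> (\<forall>\<X>. is_chi (tangent_bundle M) G \<X> \<longrightarrow>
               (\<forall>p\<in>tangent_bundle M.
                  \<forall>\<xi>\<in>tangent_space (tangent_bundle M) p.
                  \<forall>\<eta>\<in>tangent_space (tangent_bundle M) p.
                    \<Gamma>G p \<xi> \<eta> =
                      - (dir_deriv (tangent_bundle M)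
                           (tangent_projection (tangent_bundle M) G) p \<xi>) \<eta>
                      + christoffel_ring (tangent_bundle M) G \<X> p \<xi> \<eta>)))"
proof -
  interpret tangent_bundle_metric M g \<Gamma> ghat G
    by unfold_locales (use assms in auto)
  show ?thesis
    unfolding Let_def
  proof (intro conjI)
    show "embedded_ambient_structure TM G" by (rule total.ambient)
    show "riemannian_submersion TM G M g fst" by (rule submersion)
  qed (use inverse_G horizontal_vertical total.christoffel_operator_formula projection_G in
      \<open>auto simp: blinfun.bilinear_simps\<close>)
qed

end
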